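(* Let $X$ be a Banach space of infratype $p>1$ with constant $I_p(X)$, and put $$K_p(X)=\frac{2I_p(X)}{2^{1-\frac1p}-1},\qquad B_p(X)=K_p(X)+I_p(X).$$ Then, for all $r\in\mathbb N$ and $k\ge2$, $$\operatorname{Tv}_X(r,k)\le\frac{2B_p(X)}{1-2^{-1+\frac1p}}\,r^{-1+\frac1p},\qquad \operatorname{Sel}_X(r,r^{-r})\le\left(\frac{2B_p(X)}{1-2^{-1+\frac1p}}+K_p(X)\right)r^{-1+\frac1p},$$ and, for every $0<\varepsilon<1$, $$\operatorname{WeakNet}_X\left(\varepsilon,r^r\varepsilon^{-r}\right)\le\left(\frac{2B_p(X)}{1-2^{-1+\frac1p}}+K_p(X)\right)r^{-1+\frac1p}.$$
   Context: A Banach space $X$ has infratype $p\in[1,2]$ if there is a constant $I<\infty$ such that for every finite sequence $x_1,\dots,x_m\in X$, $\min_{\theta_i=\pm1}\|\sum_{i=1}^m\theta_i x_i\|\le I\left(\sum_{i=1}^m\|x_i\|^p\right)^{1/p}$; $I_p(X)$ is the least such constant. Notation: $\operatorname{dist}(A,B)=\inf\{\|a-b\|: a\in A,b\in B\}$ (a point is treated as a singleton), $[n]=\{1,\dots,n\}$, $\mathbf B_X$ is the closed unit ball, $\binom{P}{r}$ is the set of $r$-element subsets of $P$. Tverberg. For pairwise disjoint $Z_1,\dots,Z_r\subset X$, each of cardinality $k\ge2$, with $S=\bigcup_jZ_j$ and $D=\max_j\operatorname{diam}Z_j$, a colorful $k$-partition is a partition $S=S_1\sqcup\dots\sqcup S_k$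 with $|S_i\cap Z_j|=1$ for all $i\in[k],j\in[r]$. Then $\operatorname{Tv}_X(r,k)=\sup_{Z_1,\dots,Z_r}\inf\frac{\max_{i\in[k]}\operatorname{dist}(x,\operatorname{conv}S_i)}{D}$, the infimum over all points $x\in X$ and all colorful $k$-partitions. Selection. For $0<\theta\le1$, $\operatorname{Sel}_X(r,\theta)$ is the supremum over finite $P\subset X$ with $|P|\ge r$ and positive diameter of the infimum over $x\in X$ of the infimum of all $\alpha>0$ such that at least $\theta\binom{|P|}{r}$ of the sets $A\in\binom{P}{r}$ satisfy $\operatorname{conv}A\cap(x+\alpha\operatorname{diam}(P)\mathbf B_X)\ne\emptyset$. Weak nets. For $0<\varepsilon<1$ and real $M\ge1$, $\operatorname{WeakNet}_X(\varepsilon,M)=\sup_P\ \inf_{F\subset X,\,|F|\le M}\ \sup_{Y\subset P,\,|Y|\ge\varepsilon|P|}\frac{\operatorname{dist}(F,\operatorname{conv}Y)}{\operatorname{diam}P}$, where $P$ ranges over finite subsets of $X$ of positive diameter. *)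

theory Defs
  imports "HOL-Analysis.Analysis"
begin

text \<open>
  The Banach space is the type \<open>'a\<close>, passed as an \<open>itself\<close> argument where it cannot be
  inferred.  Suprema and infima of nonnegative quantities are taken in \<open>ennreal\<close>, so that an
  unbounded supremum is infinite, an empty one is 0, and an empty infimum is infinite.
\<close>

section \<open>Infratype\<close>

text \<open>
  Constants are required to be nonnegative.  This only matters for the zero space, where the
  inequality holds for every real constant and the least one would not exist otherwise.
\<close>

definition infratype_bound :: "'a::banach itself \<Rightarrow> real \<Rightarrow> real \<Rightarrow> bool" where
  "infratype_bound _ p I \<longleftrightarrow> 0 \<le> I \<and>
     (\<forall>(m::nat) (x::nat \<Rightarrow> 'a).
        Min ((\<lambda>\<theta>. norm (\<Sum>i=1..m. \<theta> i *\<^sub>R x i)) ` ({1..m} \<rightarrow>\<^sub>E {-1, 1::real}))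
          \<le> I * (\<Sum>i=1..m. norm (x i) powr p) powr (1 / p))"

definition has_infratype :: "'a::banach itself \<Rightarrow> real \<Rightarrow> bool" where
  "has_infratype X p \<longleftrightarrow> 1 \<le> p \<and> p \<le> 2 \<and> (\<exists>I. infratype_bound X p I)"

definition infratype_const :: "'a::banach itself \<Rightarrow> real \<Rightarrow> real" where
  "infratype_const X p = Inf {I. infratype_bound X p I}"

text \<open>The infimum is attained, so it is the least infratype constant.\<close>

lemma infratype_bound_infratype_const:
  fixes X :: "'a::banach itself"
  assumes "has_infratype X p"
  shows "infratype_bound X p (infratype_const X p)"
proof -
  let ?S = "{I. infratype_bound X p I}"
  have ne: "?S \<noteq> {}"
    using assms by (auto simp: has_infratype_def)
  have upper: "c \<le> Inf ?S * s" if "0 \<le> s" and *: "\<And>I. I \<in> ?S \<Longrightarrow> c \<le> I * s" for c s :: real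
  proof (cases "s = 0")
    case True
    then show ?thesis using ne * by auto
  next
    case False
    then have "c / s \<le> Inf ?S"
      using that by (intro cInf_greatest ne) (auto simp: pos_divide_le_eq)
    then show ?thesis using False that(1) by (simp add: pos_divide_le_eq)
  qed
  have "0 \<le> Inf ?S"
    by (rule cInf_greatest[OF ne]) (auto simp: infratype_bound_def)
  moreover have "Min ((\<lambda>\<theta>. norm (\<Sum>i=1..m. \<theta> i *\<^sub>R x i)) ` ({1..m} \<rightarrow>\<^sub>E {-1, 1::real}))
                   \<le> Inf ?S * (\<Sum>i=1..m. norm (x i) powr p) powr (1 / p)"
    for m :: nat and x :: "nat \<Rightarrow> 'a"
    by (rule upper) (simp_all add: infratype_bound_def del: One_nat_def)
  ultimately show ?thesis
    unfolding infratype_const_def infratype_bound_def[of X p "Inf ?S"] by blast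
qed

lemma infratype_const_le:
  "infratype_bound X p I \<Longrightarrow> infratype_const X p \<le> I"
  unfolding infratype_const_def
  by (rule cInf_lower) (auto intro!: bdd_belowI[of _ 0] simp: infratype_bound_def)

definition infratype_K :: "'a::banach itself \<Rightarrow> real \<Rightarrow> real" where
  "infratype_K X p = 2 * infratype_const X p / (2 powr (1 - 1 / p) - 1)"

definition infratype_B :: "'a::banach itself \<Rightarrow> real \<Rightarrow> real" where
  "infratype_B X p = infratype_K X p + infratype_const X p"

section \<open>Colorful Tverberg partitions\<close>

definition color_classes :: "nat \<Rightarrow> nat \<Rightarrow> (nat \<Rightarrow> 'a set) \<Rightarrow> bool" where
  "color_classes r k Z \<longleftrightarrow>
     disjoint_family_on Z {1..r} \<and> (\<forall>j\<in>{1..r}. finite (Z j) \<and> card (Z j) = k)"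

definition colorful_partition ::
    "nat \<Rightarrow> nat \<Rightarrow> (nat \<Rightarrow> 'a set) \<Rightarrow> (nat \<Rightarrow> 'a set) \<Rightarrow> bool" where
  "colorful_partition r k Z S \<longleftrightarrow>
     disjoint_family_on S {1..k} \<and>
     (\<Union>i\<in>{1..k}. S i) = (\<Union>j\<in>{1..r}. Z j) \<and>
     (\<forall>i\<in>{1..k}. \<forall>j\<in>{1..r}. card (S i \<inter> Z j) = 1)"

text \<open>Meaningful for \<open>r \<ge> 1\<close> and \<open>k \<ge> 2\<close>; the denominator is then positive.\<close>

definition Tv :: "'a::banach itself \<Rightarrow> nat \<Rightarrow> nat \<Rightarrow> ennreal" where
  "Tv _ r k =
     (SUP Z\<in>{Z :: nat \<Rightarrow> 'a set. color_classes r k Z}.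
        INF x::'a. INF S\<in>{S. colorful_partition r k Z S}.
          ennreal (Max ((\<lambda>i. setdist {x} (convex hull (S i))) ` {1..k})
                   / Max ((\<lambda>j. diameter (Z j)) ` {1..r})))"

section \<open>Selection\<close>

definition Sel :: "'a::banach itself \<Rightarrow> nat \<Rightarrow> real \<Rightarrow> ennreal" where
  "Sel _ r \<theta> =
     (SUP P\<in>{P :: 'a set. finite P \<and> card P \<ge> r \<and> diameter P > 0}.
        INF x::'a.
          INF \<alpha>\<in>{\<alpha>::real. \<alpha> > 0 \<and>
            real (card {A. A \<subseteq> P \<and> card A = r \<and>
                           convex hull A \<inter> (\<lambda>b. x + (\<alpha> * diameter P) *\<^sub>R b) ` cball 0 1 \<noteq> {}})
              \<ge> \<theta> * real (card P choose r)}.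
            ennreal \<alpha>)"

section \<open>Weak nets\<close>

text \<open>
  The sets \<open>F\<close> are required to be nonempty because \<open>setdist {} Y = 0\<close>, whereas
  an infimum over the empty set should be infinite here.
\<close>

definition WeakNet :: "'a::banach itself \<Rightarrow> real \<Rightarrow> real \<Rightarrow> ennreal" where
  "WeakNet _ \<epsilon> M =
     (SUP P\<in>{P :: 'a set. finite P \<and> diameter P > 0}.
        INF F\<in>{F :: 'a set. finite F \<and> F \<noteq> {} \<and> real (card F) \<le> M}.
          SUP Y\<in>{Y. Y \<subseteq> P \<and> real (card Y) \<ge> \<epsilon> * real (card P)}.
            ennreal (setdist F (convex hull Y) / diameter P))"

end

theory Submission
  imports Defs
begin

text \<open>
  Pairing up elements of the same color and balancing the signs of their differences halves all
  color classes at once.  Applied to the successive binary digits of weights, this rounds the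
  uniform weights \<open>l\<^sub>j / n\<^sub>j\<close> on color classes of size \<open>n\<^sub>j\<close> to a set with \<open>l\<^sub>j\<close> elements of
  color \<open>j\<close>, with an error of order \<open>L powr (1 / p)\<close> for \<open>L\<close> chosen points; the
  geometric series costs a factor \<open>1 / (1 - u)\<close>, where \<open>u = 2 powr (-1 + 1 / p)\<close>.  Recursive
  bisection of the set of parts, costing a second factor \<open>1 / (1 - u)\<close>, yields partitions all of
  whose parts have their mean near the mean \<open>x\<close> of the whole set.

  For selection, partition \<open>P\<close> into parts with at most \<open>r\<close> elements and group the \<open>r\<close>-subsets of
  \<open>P\<close> by how many points they take from each part.  A group has at most \<open>r ^ r\<close> members, and
  rounding produces one whose mean is near \<open>x\<close>.  Weak nets are built greedily from selection
  points, counting \<open>r\<close>-tuples with repetition: for subsets the ratio of binomial coefficients would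
  be bounded in the wrong direction.
\<close>

section \<open>Counting and means\<close>

text \<open>Induction on the size of \<open>E\<close>: an even class is no singleton, so any
  \<open>e\<close> has a partner \<open>f\<close> of its color, and removing both keeps every class
  even. \<open>A\<close> collects one element of each pair and \<open>g\<close> sends it to the
  other.\<close>

lemma even_classes_pairing:
  fixes col :: "'e \<Rightarrow> 'j"
  assumes "finite E" and "\<And>j. even (card {e \<in> E. col e = j})"
  shows "\<exists>A g. A \<subseteq> E \<and> inj_on g A \<and> g ` A = E - A \<and> (\<forall>a\<in>A. col (g a) = col a)"
  using assms
proof (induction "card E" arbitrary: E rule: less_induct)
  case less
  show ?case
  proof (cases "E = {}")
    case False
    then obtain e where e: "e \<in> E" by auto
    let ?C = "{x \<in> E. col x = col e}"
    have "?C \<noteq> {e}" using less.prems(2)[of "col e"] by auto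
    then obtain f where f: "f \<in> E" "col f = col e" "f \<noteq> e" using e by auto
    let ?E = "E - {e, f}"
    have "even (card {x \<in> ?E. col x = j})" for j
    proof (cases "j = col e")
      case True
      then have "{x \<in> ?E. col x = j} = ?C - {e, f}" by auto
      moreover have "card (?C - {e, f}) = card ?C - 2"
        using e f less.prems(1) by (subst card_Diff_subset) auto
      ultimately show ?thesis using less.prems(2)[of "col e"] by simp
    next
      case False
      then have "{x \<in> ?E. col x = j} = {x \<in> E. col x = j}" using f by auto
      then show ?thesis using less.prems(2) by simp
    qed
    moreover have "card ?E < card E" using e less.prems(1) by (intro psubset_card_mono) auto
    ultimately have "\<exists>A g. A \<subseteq> ?E \<and> inj_on g A \<and> g ` A = ?E - A \<and> (\<forall>a\<in>A. col (g a) = col a)"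
      using less.prems(1) by (intro less.hyps) auto
    then obtain A g where A: "A \<subseteq> ?E" "inj_on g A" "g ` A = ?E - A"
        "\<forall>a\<in>A. col (g a) = col a"
      by blast
    have e': "e \<notin> A" "f \<notin> A" using A(1) by auto
    have eq: "(g(e := f)) ` insert e A = insert f (g ` A)" using e' by auto
    have "inj_on (g(e := f)) (insert e A)"
      using A(2,3) e' by (auto simp: inj_on_def)
    moreover have "insert f (g ` A) = E - insert e A" using A(3) e f e' by auto
    moreover have "\<forall>a\<in>insert e A. col ((g(e := f)) a) = col a" using A(4) f by auto
    ultimately show ?thesis
      using A(1) e eq by (intro exI[of _ "insert e A"] exI[of _ "g(e := f)"]) auto
  qed auto
qed

text \<open>Each fibre of \<open>f\<close> contains an element with \<open>Q\<close>, so there are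
  at most as many fibres as such elements, and each fibre has at most \<open>M\<close> members. One
  good member per group thus yields a proportion \<open>1 / M\<close> of good elements.\<close>

lemma card_le_fibres:
  assumes "finite A" and "\<And>a. a \<in> A \<Longrightarrow> card {b \<in> A. f b = f a} \<le> M"
    and "\<And>a. a \<in> A \<Longrightarrow> \<exists>b\<in>A. f b = f a \<and> Q b"
  shows "card A \<le> M * card {b \<in> A. Q b}"
proof -
  have "card A = (\<Sum>c\<in>f ` A. card {b \<in> A. f b = c})"
    using sum.image_gen[OF assms(1), of "\<lambda>_. 1::nat" f] by simp
  also have "\<dots> \<le> (\<Sum>c\<in>f ` A. M)" by (intro sum_mono) (use assms(2) in auto)
  also have "\<dots> = M * card (f ` A)" by simp
  also have "f ` A = f ` {b \<in> A. Q b}" proof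
    show "f ` A \<subseteq> f ` {b \<in> A. Q b}"
    proof
      fix c assume "c \<in> f ` A"
      then obtain a where "a \<in> A" "c = f a" by auto
      then show "c \<in> f ` {b \<in> A. Q b}" using assms(3)[of a] by (metis (mono_tags, lifting) imageI mem_Collect_eq)
    qed
  qed auto
  also have "card (f ` {b \<in> A. Q b}) \<le> card {b \<in> A. Q b}"
    using assms(1) by (intro card_image_le) auto
  finally show ?thesis by simp
qed

text \<open>Peel off summands \<open>r\<close> until the rest is below \<open>2 * r\<close>, then
  halve a rest that exceeds \<open>r\<close>. The upper bound \<open>r\<close> limits the groups in
  the selection lemmas; the lower bound \<open>r / 2\<close> keeps the error of
  \<open>mean_partition\<close> small.\<close>

lemma sum_balanced:
  fixes r n :: nat
  assumes "r \<ge> 1" "n \<ge> r"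
  shows "\<exists>(m::nat) a. m \<ge> 1 \<and> (\<Sum>i<m. a i) = n \<and> (\<forall>i<m. r \<le> 2 * a i \<and> a i \<le> (r::nat))"
  using assms(2)
proof (induction n rule: less_induct)
  case (less n)
  consider "n = r" | "r < n" "n < 2 * r" | "n \<ge> 2 * r" using less.prems by linarith
  then show ?case
  proof cases
    case 1
    then show ?thesis by (intro exI[of _ "Suc 0"] exI[of _ "\<lambda>_. n"]) auto
  next
    case 2
    let ?a = "\<lambda>i::nat. if i = 0 then n div 2 else n - n div 2"
    have "sum ?a {..<2} = n" by (simp add: numeral_2_eq_2)
    moreover have "r \<le> 2 * ?a i \<and> ?a i \<le> r" for i using 2 by simp linarith
    ultimately show ?thesis by (intro exI[of _ 2] exI[of _ ?a]) simp_all
  next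
    case 3
    have "\<exists>(m::nat) a. m \<ge> 1 \<and> (\<Sum>i<m. a i) = n - r \<and> (\<forall>i<m. r \<le> 2 * a i \<and> a i \<le> r)"
      using 3 assms(1) by (intro less.IH) auto
    then obtain m :: nat and a where *: "m \<ge> 1" "(\<Sum>i<m. a i) = n - r"
        "\<forall>i<m. r \<le> 2 * a i \<and> a i \<le> r"
      by blast
    have "sum (a(m := r)) {..<Suc m} = n" using * 3 by simp
    moreover have "\<forall>i<Suc m. r \<le> 2 * (a(m := r)) i \<and> (a(m := r)) i \<le> r"
      using * by (auto simp: less_Suc_eq)
    ultimately show ?thesis by (intro exI[of _ "Suc m"] exI[of _ "a(m := r)"]) simp
  qed
qed

lemma diff_le_diameter:
  fixes P :: "'a::real_normed_vector set"
  assumes "finite P" "x \<in> P" "y \<in> P"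
  shows "norm (x - y) \<le> diameter P"
  using diameter_bounded_bound[OF finite_imp_bounded[OF assms(1)] assms(2,3)]
  by (simp add: dist_norm)

text \<open>The vectors are indexed by \<open>v\<close> instead of being the elements of the set, so
  that one vector may occur several times; tuples with repetition rely on this.\<close>

definition mean :: "('e \<Rightarrow> 'a::real_vector) \<Rightarrow> 'e set \<Rightarrow> 'a" where
  "mean v E = (1 / real (card E)) *\<^sub>R (\<Sum>e\<in>E. v e)"

lemma card_scaleR_mean: "finite E \<Longrightarrow> real (card E) *\<^sub>R mean v E = (\<Sum>e\<in>E. v e)"
  by (cases "E = {}") (auto simp: mean_def)

lemma mean_in_convex_hull:
  assumes "finite E" "E \<noteq> {}"
  shows "mean v E \<in> convex hull (v ` E)"
proof -
  have "(\<Sum>e\<in>E. (1 / real (card E)) *\<^sub>R v e) \<in> convex hull (v ` E)"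
    by (rule convex_sum[OF assms(1) convex_convex_hull]) (use assms in \<open>auto intro: hull_inc\<close>)
  then show ?thesis by (simp add: mean_def scaleR_sum_right)
qed

text \<open>Equal weights \<open>M * l / card C\<close> are rounded to integers without changing
  their sum: every element gets the integer quotient \<open>d\<close>, and as many elements as the
  remainder says, forming \<open>R\<close>, get one more.\<close>

lemma ex_weights_sum:
  assumes "finite C" and "l \<le> card C"
  shows "\<exists>N::'e \<Rightarrow> nat. (\<Sum>e\<in>C. N e) = M * l \<and>
    (\<forall>e\<in>C. N e \<le> M \<and> \<bar>real (N e) - real M * (real l / real (card C))\<bar> \<le> 1)"
proof (cases "l = card C")
  case True
  then show ?thesis
    using assms by (intro exI[of _ "\<lambda>_. M"]) (cases "C = {}"; auto)
next
  case False
  define n where "n = card C"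
  define d where "d = (M * l) div n"
  have n: "l < n" using False assms(2) by (simp add: n_def)
  have "(M * l) mod n \<le> card C" using n unfolding n_def[symmetric] by (simp add: less_imp_le)
  then obtain R where R: "R \<subseteq> C" "card R = (M * l) mod n"
    by (metis obtain_subset_with_card_n)
  have fR: "finite R" using R assms(1) finite_subset by blast
  define N where "N = (\<lambda>e. d + of_bool (e \<in> R))"
  have "(\<Sum>e\<in>C. N e) = n * d + card R"
    using R(1) assms(1) by (simp add: N_def sum.distrib n_def of_bool_def sum.If_cases Int_absorb1)
  then have s: "(\<Sum>e\<in>C. N e) = M * l" by (simp add: R(2) d_def)
  have split: "real (M * l) = real n * real d + real ((M * l) mod n)"
    unfolding d_def of_nat_mult[symmetric] of_nat_add[symmetric] by simp
  have m: "(M * l) mod n < n" using n by simp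
  have q: "real M * (real l / real n) = real d + real ((M * l) mod n) / real n"
    using split n by (simp add: field_simps)
  have b: "0 \<le> real ((M * l) mod n) / real n" "real ((M * l) mod n) / real n \<le> 1"
    using m n by (auto simp: divide_le_eq)
  \<comment> \<open>For \<open>l < n\<close> and \<open>M > 0\<close> the quotient \<open>d\<close>
    is strictly below \<open>M\<close>, which leaves room for the extra unit; hence the separate
    case \<open>l = card C\<close>.\<close>
  have "N e \<le> M" if "e \<in> C" for e
  proof (cases "M = 0")
    case True
    then have "R = {}" using R(2) fR by simp
    then show ?thesis using True by (simp add: N_def d_def)
  next
    case False
    then have "M * l < M * n" using n by simp
    then have "d < M" using n by (simp add: d_def less_mult_imp_div_less)
    then show ?thesis by (simp add: N_def)
  qed
  moreover have "\<bar>real (N e) - real M * (real l / real n)\<bar> \<le> 1" for e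
    using b unfolding q by (auto simp: N_def of_bool_def)
  ultimately show ?thesis using s unfolding n_def by blast
qed

section \<open>Rounding by sign balancing\<close>

locale infratype =
  fixes X :: "'a::banach itself" and p I :: real
  assumes p_gt: "1 < p" and p_le: "p \<le> 2" and bound: "infratype_bound X p I"
begin

definition u :: real where "u = 2 powr (-1 + 1 / p)"

text \<open>\<open>u < 1\<close> expresses \<open>1 < p\<close> and makes the geometric series
  converge; \<open>1 / 2 \<le> u\<^sup>2\<close> expresses \<open>p \<le> 2\<close> and serves to
  compare constants.\<close>

lemma u_less: "u < 1" and u_ge: "1 / 2 \<le> u\<^sup>2" and u_pos: "0 < u"
proof -
  show "u < 1" unfolding u_def using p_gt by (intro powr_less_one) auto
  show "0 < u" unfolding u_def by simp
  have "u\<^sup>2 = 2 powr (2 * (-1 + 1 / p))"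
    unfolding u_def by (simp add: power2_eq_square flip: powr_add)
  also have "\<dots> \<ge> 2 powr (-1)" using p_gt p_le by (intro powr_mono) (auto simp: field_simps)
  finally show "1 / 2 \<le> u\<^sup>2" by (simp add: powr_minus)
qed

lemma I_nonneg: "0 \<le> I"
  using bound by (simp add: infratype_bound_def)

text \<open>The infratype inequality, carried from sequences to a finite index set by an enumeration
  \<open>h\<close>. A choice of signs becomes the set \<open>U\<close> of elements with sign
  \<open>1\<close>; the minimum is attained because there are finitely many choices.\<close>

lemma ex_signs:
  fixes x :: "'e \<Rightarrow> 'a"
  assumes "finite Q"
  shows "\<exists>U\<subseteq>Q. norm (sum x U - sum x (Q - U)) \<le> I * (\<Sum>e\<in>Q. norm (x e) powr p) powr (1 / p)"
proof -
  obtain h where h: "bij_betw h {1..card Q} Q"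
    using ex_bij_betw_nat_finite_1[OF assms] by blast
  let ?m = "card Q"
  let ?S = "{1..?m} \<rightarrow>\<^sub>E {-1, 1::real}"
  let ?f = "\<lambda>\<theta>. norm (\<Sum>i=1..?m. \<theta> i *\<^sub>R x (h i))"
  have "finite ?S" by (intro finite_PiE) auto
  moreover have "?S \<noteq> {}" by (simp add: PiE_eq_empty_iff)
  ultimately have "Min (?f ` ?S) \<in> ?f ` ?S" by (intro Min_in) auto
  then obtain \<theta> where \<theta>: "\<theta> \<in> ?S" "Min (?f ` ?S) = ?f \<theta>" by auto
  have "?f \<theta> \<le> I * (\<Sum>i=1..?m. norm (x (h i)) powr p) powr (1 / p)"
    using bound unfolding infratype_bound_def \<theta>(2)[symmetric]
    by (elim conjE allE[of _ ?m] allE[of _ "\<lambda>i. x (h i)"])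
  also have "(\<Sum>i=1..?m. norm (x (h i)) powr p) = (\<Sum>e\<in>Q. norm (x e) powr p)"
    using sum.reindex_bij_betw[OF h] by simp
  finally have le: "?f \<theta> \<le> I * (\<Sum>e\<in>Q. norm (x e) powr p) powr (1 / p)" .
  define U where "U = h ` {i\<in>{1..?m}. \<theta> i = 1}"
  have inj: "inj_on h {1..?m}" and im: "h ` {1..?m} = Q" using h by (auto simp: bij_betw_def)
  have U: "U \<subseteq> Q" using im by (auto simp: U_def)
  have \<theta>_eq: "\<theta> i = (if h i \<in> U then 1 else -1)" if "i \<in> {1..?m}" for i
  proof -
    have "h i \<in> U \<longleftrightarrow> i \<in> {i\<in>{1..?m}. \<theta> i = 1}"
      unfolding U_def by (intro inj_on_image_mem_iff[OF inj that]) blast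
    then have "h i \<in> U \<longleftrightarrow> \<theta> i = 1" using that by blast
    moreover have "\<theta> i \<in> {-1, 1}" using PiE_mem[OF \<theta>(1) that] .
    ultimately show ?thesis by auto
  qed
  have "(\<Sum>i=1..?m. \<theta> i *\<^sub>R x (h i)) = (\<Sum>i=1..?m. (if h i \<in> U then x (h i) else - x (h i)))"
    by (intro sum.cong) (auto simp: \<theta>_eq)
  also have "\<dots> = (\<Sum>e\<in>Q. if e \<in> U then x e else - x e)"
    using sum.reindex_bij_betw[OF h, of "\<lambda>e. if e \<in> U then x e else - x e"] by simp
  also have "\<dots> = sum x U - sum x (Q - U)"
    using assms U by (simp add: sum.If_cases Int_absorb1 sum_negf Diff_eq)
  finally show ?thesis using le U by auto
qed

text \<open>Pair the elements within each color and balance the signs of the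
  \<open>card E / 2\<close> differences, each of norm at most \<open>D\<close>. Every pair sends one
  element to \<open>U\<close> and the other to \<open>E - U\<close>, so all classes are halved
  exactly.\<close>

lemma ex_halving:
  fixes v :: "'e \<Rightarrow> 'a" and col :: "'e \<Rightarrow> 'j"
  assumes fin: "finite E" and even: "\<And>j. even (card {e \<in> E. col e = j})"
    and D: "\<And>e f. e \<in> E \<Longrightarrow> f \<in> E \<Longrightarrow> col e = col f \<Longrightarrow> norm (v e - v f) \<le> D"
  shows "\<exists>U\<subseteq>E. (\<forall>j. 2 * card {e \<in> U. col e = j} = card {e \<in> E. col e = j}) \<and>
    norm (sum v U - sum v (E - U)) \<le> I * D * (real (card E) / 2) powr (1 / p)"
proof (cases "E = {}")
  case False
  obtain A g where A: "A \<subseteq> E" "inj_on g A" "g ` A = E - A" "\<forall>a\<in>A. col (g a) = col a"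
    using even_classes_pairing[OF fin even] by blast
  have fA: "finite A" using A(1) fin finite_subset by blast
  have D0: "0 \<le> D" using D False by fastforce
  let ?x = "\<lambda>e. v e - v (g e)"
  obtain B where B: "B \<subseteq> A"
      "norm (sum ?x B - sum ?x (A - B)) \<le> I * (\<Sum>e\<in>A. norm (?x e) powr p) powr (1 / p)"
    using ex_signs[OF fA, of ?x] by blast
  have fB: "finite B" using B(1) fA finite_subset by blast
  \<comment> \<open>From a pair \<open>a\<close>, \<open>g a\<close> the set \<open>U\<close> takes
    \<open>a\<close> if the difference has sign plus, that is \<open>a \<in> B\<close>, and
    \<open>g a\<close> otherwise.\<close>
  define U where "U = B \<union> g ` (A - B)"
  have disj: "A \<inter> g ` A = {}" using A(3) by auto
  have E: "E = A \<union> g ` A" using A(1,3) by auto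
  have gdiff: "g ` A - g ` C = g ` (A - C)" if "C \<subseteq> A" for C
    using A(2) that by (simp add: inj_on_image_set_diff)
  have EU: "E - U = (A - B) \<union> g ` B"
    unfolding U_def E using disj B(1) gdiff[of "A - B"] A(2)
    by (auto simp: double_diff inj_on_def)
  have "A - (A - B) = B" using B(1) by auto
  have sum_g: "sum v (g ` C) = sum (\<lambda>e. v (g e)) C" if "C \<subseteq> A" for C
    using A(2) that by (subst sum.reindex) (auto intro: inj_on_subset)
  have s1: "sum v U = sum v B + sum (\<lambda>e. v (g e)) (A - B)"
    unfolding U_def using B(1) disj fA fB
    by (subst sum.union_disjoint) (auto simp: sum_g)
  have s2: "sum v (E - U) = sum v (A - B) + sum (\<lambda>e. v (g e)) B"
    unfolding EU using B(1) disj fA fB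
    by (subst sum.union_disjoint) (auto simp: sum_g)
  have eq: "sum v U - sum v (E - U) = sum ?x B - sum ?x (A - B)"
    unfolding s1 s2 by (simp add: sum_subtractf)
  have le: "I * (\<Sum>e\<in>A. norm (?x e) powr p) powr (1 / p) \<le> I * (D * (real (card E) / 2) powr (1 / p))"
  proof (intro mult_left_mono I_nonneg)
    have "(\<Sum>e\<in>A. norm (?x e) powr p) \<le> (\<Sum>e\<in>A. D powr p)"
      using A p_gt by (intro sum_mono powr_mono2 D) auto
    also have "\<dots> = D powr p * real (card A)" by simp
    also have "real (card A) = real (card E) / 2"
    proof -
      have "card E = card A + card (g ` A)"
        unfolding E using disj fA by (intro card_Un_disjoint) auto
      then show ?thesis using A(2) by (simp add: card_image)
    qed
    finally have "(\<Sum>e\<in>A. norm (?x e) powr p) powr (1 / p)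
        \<le> (D powr p * (real (card E) / 2)) powr (1 / p)"
      using p_gt by (intro powr_mono2 sum_nonneg) auto
    also have "\<dots> = D * (real (card E) / 2) powr (1 / p)"
      using p_gt D0 by (simp only: powr_mult powr_powr) simp
    finally show "(\<Sum>e\<in>A. norm (?x e) powr p) powr (1 / p) \<le> D * (real (card E) / 2) powr (1 / p)" .
  qed
  have cnt: "2 * card {e \<in> U. col e = j} = card {e \<in> E. col e = j}" for j
  proof -
    let ?c = "\<lambda>S. {e \<in> S. col e = j}"
    have im: "?c (g ` C) = g ` ?c C" if "C \<subseteq> A" for C using A(4) that by auto
    have cg: "card (?c (g ` C)) = card (?c C)" if "C \<subseteq> A" for C
      unfolding im[OF that] using A(2) that by (intro card_image) (auto intro: inj_on_subset)
    have un: "card (?c (C \<union> g ` C')) = card (?c C) + card (?c C')"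
      if "C \<subseteq> A" "C' \<subseteq> A" for C C'
    proof -
      have "?c (C \<union> g ` C') = ?c C \<union> ?c (g ` C')" by auto
      moreover have "?c C \<inter> ?c (g ` C') = {}" using disj that by blast
      moreover have "finite C" "finite C'" using that fA finite_subset by auto
      ultimately have "card (?c (C \<union> g ` C')) = card (?c C) + card (?c (g ` C'))"
        by (simp add: card_Un_disjoint)
      then show ?thesis by (simp add: cg that)
    qed
    have "?c A = ?c B \<union> ?c (A - B)" using B(1) by auto
    then have "card (?c A) = card (?c B) + card (?c (A - B))"
      using fA fB by (subst card_Un_disjoint[symmetric]) auto
    then show ?thesis
      using un[of B "A - B"] un[of A A] B(1) by (simp add: U_def E)
  qed
  have "norm (sum v U - sum v (E - U)) \<le> I * D * (real (card E) / 2) powr (1 / p)"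
    using B(2) le unfolding eq mult.assoc by (rule order_trans)
  moreover have "U \<subseteq> E" unfolding U_def E using B(1) by auto
  ultimately show ?thesis using cnt by blast
next
  case True
  then show ?thesis by simp
qed

text \<open>The weights are \<open>N e / 2 ^ m\<close>, and the induction removes their last binary
  digit. Within each color half of the odd \<open>N e\<close> are rounded up and half down, so the
  totals \<open>l j\<close> persist, and \<open>ex_halving\<close> picks the halves so that the
  weighted sum moves little. Once \<open>m = 0\<close> the weights are \<open>0\<close> or
  \<open>1\<close> and describe a set.\<close>

lemma dyadic_rounding:
  fixes v :: "'e \<Rightarrow> 'a" and col :: "'e \<Rightarrow> 'j" and N :: "'e \<Rightarrow> nat"
  assumes fin: "finite E"
    and D: "\<And>e f. e \<in> E \<Longrightarrow> f \<in> E \<Longrightarrow> col e = col f \<Longrightarrow> norm (v e - v f) \<le> D" and D0: "0 \<le> D"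
    and N: "\<And>e. e \<in> E \<Longrightarrow> N e \<le> 2 ^ m" "\<And>j. (\<Sum>e | e \<in> E \<and> col e = j. N e) = 2 ^ m * l j"
  shows "\<exists>W\<subseteq>E. (\<forall>j. card {e \<in> W. col e = j} = l j) \<and>
    norm (sum v W - (1 / 2 ^ m) *\<^sub>R (\<Sum>e\<in>E. real (N e) *\<^sub>R v e))
      \<le> I * D * real (\<Sum>j\<in>col ` E. l j) powr (1 / p) / 2 * (\<Sum>k<m. u ^ k)"
  using N
proof (induction m arbitrary: N)
  case 0
  define W where "W = {e \<in> E. N e = 1}"
  have N: "N e = (if e \<in> W then 1 else 0)" if "e \<in> E" for e
    using 0(1)[OF that] that unfolding W_def by auto
  have "card {e \<in> W. col e = j} = l j" for j
  proof -
    have "(\<Sum>e | e \<in> E \<and> col e = j. N e) = (\<Sum>e | e \<in> E \<and> col e = j. if e \<in> W then 1 else 0)"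
      by (intro sum.cong) (auto simp: N)
    also have "\<dots> = card ({e \<in> E. col e = j} \<inter> W)"
      using fin by (simp add: sum.If_cases)
    also have "{e \<in> E. col e = j} \<inter> W = {e \<in> W. col e = j}" by (auto simp: W_def)
    finally show ?thesis using 0(2)[of j] by simp
  qed
  moreover have "(\<Sum>e\<in>E. real (N e) *\<^sub>R v e) = sum v W"
  proof -
    have "(\<Sum>e\<in>E. real (N e) *\<^sub>R v e) = (\<Sum>e\<in>E. if e \<in> W then v e else 0)"
      by (intro sum.cong) (auto simp: N)
    also have "\<dots> = sum v (E \<inter> W)" using fin by (simp add: sum.If_cases)
    also have "E \<inter> W = W" by (auto simp: W_def)
    finally show ?thesis .
  qed
  moreover have "W \<subseteq> E" by (auto simp: W_def)
  ultimately show ?case by (intro exI[of _ W]) simp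
next
  case (Suc m)
  define Od where "Od = {e \<in> E. odd (N e)}"
  define L where "L = (\<Sum>j\<in>col ` E. l j)"
  have Od: "Od \<subseteq> E" "finite Od" using fin by (auto simp: Od_def)
  have Odj: "{e \<in> Od. col e = j} = {e \<in> {e \<in> E. col e = j}. odd (N e)}" for j
    by (auto simp: Od_def)
  \<comment> \<open>The total of a class is even, so it has an even number of odd terms.\<close>
  have "even (card {e \<in> Od. col e = j})" for j
  proof -
    have "even (\<Sum>e | e \<in> E \<and> col e = j. N e)" unfolding Suc.prems(2) by simp
    then show ?thesis unfolding Odj using fin by (subst (asm) even_sum_iff) auto
  qed
  then obtain U where U: "U \<subseteq> Od" "\<And>j. 2 * card {e \<in> U. col e = j} = card {e \<in> Od. col e = j}"
      "norm (sum v U - sum v (Od - U)) \<le> I * D * (real (card Od) / 2) powr (1 / p)"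
    using ex_halving[OF Od(2), of col v D] D Od(1) by blast
  define N' where "N' = (\<lambda>e. N e div 2 + (if e \<in> U then 1 else 0))"
  \<comment> \<open>An additive form of the rounding rule, which avoids truncated subtraction of
    natural numbers.\<close>
  have N'2: "2 * N' e + (if e \<in> Od then 1 else 0) = N e + 2 * (if e \<in> U then 1 else 0)"
    if "e \<in> E" for e
    using that U(1) unfolding N'_def Od_def by (auto elim: oddE)
  \<comment> \<open>An odd weight differs from \<open>2 ^ Suc m\<close>, so rounding it up stays
    within the bound.\<close>
  have le: "N' e \<le> 2 ^ m" if "e \<in> E" for e
  proof (cases "e \<in> U")
    case True
    then have "odd (N e)" using U(1) by (auto simp: Od_def)
    then have "N e \<noteq> 2 ^ Suc m" by auto
    then show ?thesis using Suc.prems(1)[OF that] True unfolding N'_def by simp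
  next
    case False
    then show ?thesis using Suc.prems(1)[OF that] unfolding N'_def by simp
  qed
  have sum': "(\<Sum>e | e \<in> E \<and> col e = j. N' e) = 2 ^ m * l j" for j
  proof -
    let ?C = "{e \<in> E. col e = j}"
    have ind: "(\<Sum>e\<in>?C. if e \<in> S then 1 else 0) = card {e \<in> S. col e = j}" if "S \<subseteq> E" for S
    proof -
      have "?C \<inter> S = {e \<in> S. col e = j}" using that by auto
      then show ?thesis using fin by (simp add: sum.If_cases)
    qed
    have "(\<Sum>e\<in>?C. 2 * N' e + (if e \<in> Od then 1 else 0)) = (\<Sum>e\<in>?C. N e + 2 * (if e \<in> U then 1 else 0))"
      by (intro sum.cong) (use N'2 in auto)
    then have "2 * (\<Sum>e\<in>?C. N' e) + card {e \<in> Od. col e = j} = (\<Sum>e\<in>?C. N e) + 2 * card {e \<in> U. col e = j}"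
      using ind[OF Od(1)] ind[of U] U(1) Od(1) unfolding sum.distrib sum_distrib_left[symmetric] by simp
    then show ?thesis using U(2)[of j] Suc.prems(2)[of j] by simp
  qed
  obtain W where W: "W \<subseteq> E" "\<And>j. card {e \<in> W. col e = j} = l j"
    "norm (sum v W - (1 / 2 ^ m) *\<^sub>R (\<Sum>e\<in>E. real (N' e) *\<^sub>R v e))
      \<le> I * D * real L powr (1 / p) / 2 * (\<Sum>k<m. u ^ k)"
    using Suc.IH[of N', OF le sum'] unfolding L_def by blast
  have diff: "2 *\<^sub>R (\<Sum>e\<in>E. real (N' e) *\<^sub>R v e) - (\<Sum>e\<in>E. real (N e) *\<^sub>R v e) = sum v U - sum v (Od - U)"
  proof -
    have "2 *\<^sub>R (\<Sum>e\<in>E. real (N' e) *\<^sub>R v e) - (\<Sum>e\<in>E. real (N e) *\<^sub>R v e)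
        = (\<Sum>e\<in>E. (2 * real (N' e) - real (N e)) *\<^sub>R v e)"
      by (simp add: scaleR_sum_right sum_subtractf scaleR_diff_left)
    also have "\<dots> = (\<Sum>e\<in>E. (if e \<in> U then v e else 0) - (if e \<in> Od - U then v e else 0))"
    proof (intro sum.cong refl)
      fix e assume e: "e \<in> E"
      have "2 * real (N' e) + (if e \<in> Od then 1 else 0) = real (N e) + 2 * (if e \<in> U then 1 else 0)"
        using arg_cong[OF N'2[OF e], of real] by (simp split: if_splits)
      then have "2 * real (N' e) - real (N e) = 2 * (if e \<in> U then 1 else 0) - (if e \<in> Od then 1 else 0)"
        by linarith
      then show "(2 * real (N' e) - real (N e)) *\<^sub>R v e
          = (if e \<in> U then v e else 0) - (if e \<in> Od - U then v e else 0)"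
        using U(1) by (auto split: if_splits)
    qed
    also have "\<dots> = sum v (E \<inter> U) - sum v (E \<inter> (Od - U))"
      using fin by (simp only: sum_subtractf sum.inter_restrict)
    also have "E \<inter> U = U" using U(1) Od(1) by blast
    also have "E \<inter> (Od - U) = Od - U" using Od(1) by blast
    finally show ?thesis .
  qed
  have total: "(\<Sum>e\<in>E. N e) = 2 ^ Suc m * L"
  proof -
    have "(\<Sum>e\<in>E. N e) = (\<Sum>j\<in>col ` E. \<Sum>e | e \<in> E \<and> col e = j. N e)"
      using sum.image_gen[OF fin] by blast
    then show ?thesis unfolding Suc.prems(2) L_def by (simp add: sum_distrib_left)
  qed
  \<comment> \<open>Odd weights are at least \<open>1\<close>, so their number is at most the total
    weight \<open>2 ^ Suc m * L\<close>.\<close>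
  have "card Od = (\<Sum>e\<in>Od. 1)" by simp
  also have "\<dots> \<le> (\<Sum>e\<in>Od. N e)" by (intro sum_mono) (auto simp: Od_def elim: oddE)
  also have "\<dots> \<le> (\<Sum>e\<in>E. N e)" by (intro sum_mono2 fin Od) auto
  finally have cOd: "card Od \<le> 2 ^ Suc m * L" unfolding total .
  then have "real (card Od) \<le> real (2 ^ Suc m * L)" unfolding of_nat_le_iff .
  then have cOd: "real (card Od) / 2 \<le> 2 ^ m * real L" by simp
  have "I * D * (real (card Od) / 2) powr (1 / p) \<le> I * D * (2 ^ m * real L) powr (1 / p)"
    using D0 I_nonneg p_gt cOd by (intro mult_left_mono powr_mono2) auto
  \<comment> \<open>Writing \<open>1 / p\<close> as \<open>1 + (-1 + 1 / p)\<close> splits off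
    \<open>2 ^ m\<close>, which the scaling \<open>1 / 2 ^ Suc m\<close> below turns into
    \<open>1 / 2\<close>; what remains is the term \<open>u ^ m\<close> of the series.\<close>
  also have "(2 ^ m * real L) powr (1 / p) = 2 ^ m * u ^ m * real L powr (1 / p)"
  proof -
    have "(2 ^ m) powr (1 / p) = (2 powr real m) powr (1 / p)" by (simp add: powr_realpow)
    also have "\<dots> = 2 powr (real m + real m * (-1 + 1 / p))"
      by (simp only: powr_powr) (simp add: algebra_simps)
    also have "\<dots> = 2 ^ m * u ^ m"
    proof -
      have "u ^ m = 2 powr (real m * (-1 + 1 / p))"
        using u_pos by (simp only: powr_realpow[symmetric] u_def powr_powr mult.commute)
      then show ?thesis unfolding powr_add by (simp add: powr_realpow)
    qed
    finally show ?thesis by (simp only: powr_mult)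
  qed
  finally have step: "norm (sum v U - sum v (Od - U)) \<le> I * D * (2 ^ m * u ^ m * real L powr (1 / p))"
    using U(3) by linarith
  let ?A = "\<Sum>e\<in>E. real (N e) *\<^sub>R v e" and ?A' = "\<Sum>e\<in>E. real (N' e) *\<^sub>R v e"
  have "sum v W - (1 / 2 ^ Suc m) *\<^sub>R ?A
      = (sum v W - (1 / 2 ^ m) *\<^sub>R ?A') + (1 / 2 ^ Suc m) *\<^sub>R (2 *\<^sub>R ?A' - ?A)"
    by (simp add: scaleR_diff_right)
  also have "norm \<dots> \<le> norm (sum v W - (1 / 2 ^ m) *\<^sub>R ?A') + norm ((1 / 2 ^ Suc m) *\<^sub>R (2 *\<^sub>R ?A' - ?A))"
    by (rule norm_triangle_ineq)
  also have "norm ((1 / 2 ^ Suc m) *\<^sub>R (2 *\<^sub>R ?A' - ?A)) = (1 / 2 ^ Suc m) * norm (sum v U - sum v (Od - U))"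
    unfolding diff by simp
  also have "\<dots> \<le> (1 / 2 ^ Suc m) * (I * D * (2 ^ m * u ^ m * real L powr (1 / p)))"
    by (intro mult_left_mono step) simp
  also have "\<dots> = I * D * real L powr (1 / p) / 2 * u ^ m" by simp
  finally have "norm (sum v W - (1 / 2 ^ Suc m) *\<^sub>R ?A)
      \<le> I * D * real L powr (1 / p) / 2 * (\<Sum>k<Suc m. u ^ k)"
    using W(3) by (simp only: sum.lessThan_Suc distrib_left) linarith
  then show ?case using W(1,2) unfolding L_def by blast
qed

lemma sum_u_le: "(\<Sum>k<m. u ^ k) \<le> 1 / (1 - u)"
proof -
  have "(\<Sum>k<m. u ^ k) = (1 - u ^ m) / (1 - u)"
    using u_less by (simp add: sum_gp_strict)
  also have "\<dots> \<le> 1 / (1 - u)" using u_less u_pos by (intro divide_right_mono) auto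
  finally show ?thesis .
qed

text \<open>The uniform weights need not be dyadic, so they are approximated by multiples of
  \<open>1 / 2 ^ m\<close>. The error bound \<open>b\<close> of \<open>dyadic_rounding\<close> does
  not depend on \<open>m\<close>, and the approximation adds at most \<open>V / 2 ^ m\<close>, which
  vanishes in the limit.\<close>

lemma rounding:
  fixes v :: "'e \<Rightarrow> 'a" and col :: "'e \<Rightarrow> 'j"
  assumes fin: "finite E"
    and D: "\<And>e f. e \<in> E \<Longrightarrow> f \<in> E \<Longrightarrow> col e = col f \<Longrightarrow> norm (v e - v f) \<le> D" and D0: "0 \<le> D"
    and l: "\<And>j. l j \<le> card {e \<in> E. col e = j}"
  shows "\<exists>W\<subseteq>E. (\<forall>j. card {e \<in> W. col e = j} = l j) \<and>
    norm (sum v W - (\<Sum>j\<in>col ` E. real (l j) *\<^sub>R mean v {e \<in> E. col e = j}))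
      \<le> I * D * real (\<Sum>j\<in>col ` E. l j) powr (1 / p) / (2 * (1 - u))"
proof -
  let ?C = "\<lambda>j. {e \<in> E. col e = j}"
  define s where "s = (\<Sum>j\<in>col ` E. real (l j) *\<^sub>R mean v (?C j))"
  define b where "b = I * D * real (\<Sum>j\<in>col ` E. l j) powr (1 / p) / (2 * (1 - u))"
  define V where "V = (\<Sum>e\<in>E. norm (v e))"
  define Ws where "Ws = {W. W \<subseteq> E \<and> (\<forall>j. card {e \<in> W. col e = j} = l j)}"
  define err where "err W = norm (sum v W - s)" for W
  have finWs: "finite Ws" unfolding Ws_def using fin by simp
  have app: "\<exists>W\<in>Ws. err W \<le> b + V / 2 ^ m" for m
  proof -
    have "\<forall>j. \<exists>N::'e \<Rightarrow> nat. (\<Sum>e\<in>?C j. N e) = 2 ^ m * l j \<and>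
        (\<forall>e\<in>?C j. N e \<le> 2 ^ m \<and> \<bar>real (N e) - real (2 ^ m) * (real (l j) / real (card (?C j)))\<bar> \<le> 1)"
      using fin by (intro allI ex_weights_sum l) auto
    from choice[OF this] obtain N where
      "\<forall>j. (\<Sum>e\<in>?C j. N j e) = 2 ^ m * l j \<and> (\<forall>e\<in>?C j. N j e \<le> 2 ^ m \<and>
        \<bar>real (N j e) - real (2 ^ m) * (real (l j) / real (card (?C j)))\<bar> \<le> 1)" ..
    then have N: "(\<Sum>e\<in>?C j. N j e) = 2 ^ m * l j" "e \<in> ?C j \<Longrightarrow> N j e \<le> 2 ^ m"
        "e \<in> ?C j \<Longrightarrow> \<bar>real (N j e) - real (2 ^ m) * (real (l j) / real (card (?C j)))\<bar> \<le> 1" for j e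
      by blast+
    define N0 where "N0 e = N (col e) e" for e
    have N_sum: "(\<Sum>e\<in>?C j. N0 e) = 2 ^ m * l j" for j
      unfolding N(1)[of j, symmetric] by (intro sum.cong) (auto simp: N0_def)
    have N_le: "N0 e \<le> 2 ^ m" if "e \<in> E" for e using N(2)[of e "col e"] that by (simp add: N0_def)
    from dyadic_rounding[of E col v D N0 m l, OF fin D D0 N_le N_sum]
    obtain W where W: "W \<subseteq> E" "\<forall>j. card {e \<in> W. col e = j} = l j"
      "norm (sum v W - (1 / 2 ^ m) *\<^sub>R (\<Sum>e\<in>E. real (N0 e) *\<^sub>R v e))
        \<le> I * D * real (\<Sum>j\<in>col ` E. l j) powr (1 / p) / 2 * (\<Sum>k<m. u ^ k)"
      by blast
    have s: "s = (\<Sum>e\<in>E. (real (l (col e)) / real (card (?C (col e)))) *\<^sub>R v e)"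
    proof -
      have "(\<Sum>e\<in>E. (real (l (col e)) / real (card (?C (col e)))) *\<^sub>R v e)
        = (\<Sum>j\<in>col ` E. \<Sum>e\<in>?C j. (real (l (col e)) / real (card (?C (col e)))) *\<^sub>R v e)"
        using sum.image_gen[OF fin] by blast
      also have "\<dots> = s" unfolding s_def mean_def
        by (intro sum.cong refl) (auto simp: scaleR_sum_right)
      finally show ?thesis by simp
    qed
    have "(1 / 2 ^ m) *\<^sub>R (\<Sum>e\<in>E. real (N0 e) *\<^sub>R v e) - s
        = (\<Sum>e\<in>E. (real (N0 e) / 2 ^ m - real (l (col e)) / real (card (?C (col e)))) *\<^sub>R v e)"
      unfolding s by (simp add: scaleR_sum_right sum_subtractf scaleR_diff_left)
    also have "norm \<dots> \<le> (\<Sum>e\<in>E. norm (v e) / 2 ^ m)"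
    proof (intro sum_norm_le)
      fix e assume e: "e \<in> E"
      let ?w = "real (l (col e)) / real (card (?C (col e)))"
      have "real (N0 e) / 2 ^ m - ?w = (real (N0 e) - real (2 ^ m) * ?w) / 2 ^ m"
        by (simp add: diff_divide_distrib)
      then have "\<bar>real (N0 e) / 2 ^ m - ?w\<bar> = \<bar>real (N0 e) - real (2 ^ m) * ?w\<bar> / 2 ^ m"
        by (simp add: abs_divide)
      also have "\<dots> \<le> 1 / 2 ^ m" using N(3)[of e "col e"] e by (intro divide_right_mono) (auto simp: N0_def)
      finally have "\<bar>real (N0 e) / 2 ^ m - ?w\<bar> * norm (v e) \<le> 1 / 2 ^ m * norm (v e)"
        by (intro mult_right_mono) auto
      then show "norm ((real (N0 e) / 2 ^ m - ?w) *\<^sub>R v e) \<le> norm (v e) / 2 ^ m" by simp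
    qed
    also have "\<dots> = V / 2 ^ m" by (simp add: V_def sum_divide_distrib)
    finally have 1: "norm ((1 / 2 ^ m) *\<^sub>R (\<Sum>e\<in>E. real (N0 e) *\<^sub>R v e) - s) \<le> V / 2 ^ m" .
    have "I * D * real (\<Sum>j\<in>col ` E. l j) powr (1 / p) / 2 * (\<Sum>k<m. u ^ k)
        \<le> I * D * real (\<Sum>j\<in>col ` E. l j) powr (1 / p) / 2 * (1 / (1 - u))"
      using D0 I_nonneg by (intro mult_left_mono sum_u_le) auto
    also have "\<dots> = b" by (simp add: b_def)
    finally have "norm (sum v W - (1 / 2 ^ m) *\<^sub>R (\<Sum>e\<in>E. real (N0 e) *\<^sub>R v e)) \<le> b"
      using W(3) by linarith
    then have "err W \<le> b + V / 2 ^ m"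
      unfolding err_def using norm_diff_triangle_le 1 by blast
    then show ?thesis using W(1,2) by (auto simp: Ws_def)
  qed
  then have ne: "Ws \<noteq> {}" by blast
  \<comment> \<open>The set found above may vary with \<open>m\<close>. Among the finitely many
    candidates one has the least error, and its error is below \<open>b + V / 2 ^ m\<close> for all
    \<open>m\<close> at once.\<close>
  define W where "W = arg_min_on err Ws"
  have W: "W \<in> Ws" "\<And>W'. W' \<in> Ws \<Longrightarrow> err W \<le> err W'"
    unfolding W_def using arg_min_if_finite(1)[OF finWs ne] arg_min_least[OF finWs ne] by auto
  have "err W \<le> b + V / 2 ^ m" for m
    using app[of m] W(2) by (meson order_trans)
  moreover have "(\<lambda>m. b + V / 2 ^ m) \<longlonglongrightarrow> b + 0"
    by (intro tendsto_add tendsto_const LIMSEQ_divide_realpow_zero) simp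
  ultimately have "err W \<le> b" by (intro LIMSEQ_le_const[of _ b]) auto
  then show ?thesis using W(1) unfolding Ws_def err_def b_def s_def by blast
qed

section \<open>Partitions into parts with nearby means\<close>

lemma powr_shift: "0 < x \<Longrightarrow> x powr (-1 + 1 / p) = x powr (1 / p) / x"
  by (subst powr_add) (simp add: powr_minus divide_inverse)

text \<open>All classes have the same size, so choosing \<open>a\<close> elements of each aims at
  \<open>card J * a\<close> times the mean of \<open>E\<close>. The deviations of
  \<open>sum v W\<close> and \<open>sum v (E - W)\<close> from their targets are opposite; since
  \<open>a \<le> b\<close>, dividing by the size of the smaller side \<open>W\<close> bounds both
  means.\<close>

lemma split_classes:
  fixes v :: "'e \<Rightarrow> 'a" and col :: "'e \<Rightarrow> 'j"
  assumes fin: "finite E"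
    and D: "\<And>e f. e \<in> E \<Longrightarrow> f \<in> E \<Longrightarrow> col e = col f \<Longrightarrow> norm (v e - v f) \<le> D" and D0: "0 \<le> D"
    and J: "finite J" "J \<noteq> {}" "col ` E \<subseteq> J"
    and ab: "1 \<le> a" "a \<le> b" and card: "\<And>j. j \<in> J \<Longrightarrow> card {e \<in> E. col e = j} = a + b"
  shows "\<exists>W\<subseteq>E. (\<forall>j\<in>J. card {e \<in> W. col e = j} = a \<and> card {e \<in> E - W. col e = j} = b) \<and>
    norm (mean v W - mean v E) \<le> I * D * real (card J * a) powr (-1 + 1 / p) / (2 * (1 - u)) \<and>
    norm (mean v (E - W) - mean v E) \<le> I * D * real (card J * a) powr (-1 + 1 / p) / (2 * (1 - u))"
proof -
  let ?C = "\<lambda>S j. {e \<in> S. col e = j}"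
  have "?C E j \<noteq> {}" if "j \<in> J" for j
    using card[OF that] ab by (metis add_is_0 card.empty not_one_le_zero)
  then have colE: "col ` E = J" using J(3) by blast
  have cardS: "card S = (\<Sum>j\<in>J. card (?C S j))" if "S \<subseteq> E" for S
  proof -
    have "finite S" "col ` S \<subseteq> J" using that fin J(3) finite_subset by auto
    then show ?thesis using sum.group[of S J col "\<lambda>_. 1::nat"] J(1) by simp
  qed
  \<comment> \<open>\<open>rounding\<close> asks for a number for every color of the type; classes
    outside \<open>J\<close> are empty, which forces \<open>0\<close> there.\<close>
  define l where "l = (\<lambda>j. if j \<in> J then a else 0)"
  have "l j \<le> card (?C E j)" for j using card[of j] by (auto simp: l_def)
  then obtain W where W: "W \<subseteq> E" "\<And>j. card (?C W j) = l j"
    "norm (sum v W - (\<Sum>j\<in>J. real (l j) *\<^sub>R mean v (?C E j)))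
      \<le> I * D * real (\<Sum>j\<in>J. l j) powr (1 / p) / (2 * (1 - u))"
    using rounding[of E col v D l, OF fin D D0] unfolding colE by blast
  have Wj: "card (?C W j) = a" if "j \<in> J" for j using W(2)[of j] that by (simp add: l_def)
  have EWj: "card (?C (E - W) j) = b" if "j \<in> J" for j
  proof -
    have "?C (E - W) j = ?C E j - ?C W j" by auto
    moreover have "card (?C E j - ?C W j) = card (?C E j) - card (?C W j)"
      using W(1) fin finite_subset[OF W(1)] by (intro card_Diff_subset) auto
    ultimately show ?thesis using card[OF that] Wj[OF that] by simp
  qed
  define n1 n2 where "n1 = real (card J * a)" and "n2 = real (card J * b)"
  have cJ: "card J > 0" using J by (simp add: card_gt_0_iff)
  have n: "0 < n1" "n1 \<le> n2" using cJ ab by (auto simp: n1_def n2_def)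
  have cW: "real (card W) = n1" using cardS[OF W(1)] by (simp add: n1_def Wj)
  have "card (E - W) = (\<Sum>j\<in>J. b)"
    unfolding cardS[OF Diff_subset] by (intro sum.cong refl EWj)
  then have cEW: "real (card (E - W)) = n2" by (simp add: n2_def)
  have cE: "real (card E) = n1 + n2"
    using cardS[of E] by (simp add: n1_def n2_def card algebra_simps)
  have "(\<Sum>j\<in>J. real (l j) *\<^sub>R mean v (?C E j)) = (\<Sum>j\<in>J. (real a / real (a + b)) *\<^sub>R sum v (?C E j))"
    by (intro sum.cong) (auto simp: l_def mean_def card)
  also have "\<dots> = (real a / real (a + b)) *\<^sub>R sum v E"
    unfolding scaleR_sum_right[symmetric] using sum.group[OF fin J(1,3), of v] by simp
  also have "\<dots> = n1 *\<^sub>R mean v E"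
    unfolding mean_def cE using cJ ab by (simp add: n1_def n2_def distrib_left[symmetric])
  finally have err: "norm (sum v W - n1 *\<^sub>R mean v E) \<le> I * D * n1 powr (1 / p) / (2 * (1 - u))"
    using W(3) by (simp add: l_def n1_def)
  have bd: "I * D * n1 powr (1 / p) / (2 * (1 - u)) / n1 = I * D * n1 powr (-1 + 1 / p) / (2 * (1 - u))"
    unfolding powr_shift[OF n(1)] by simp
  have "mean v W - mean v E = (1 / n1) *\<^sub>R (sum v W - n1 *\<^sub>R mean v E)"
    using n(1) by (simp add: mean_def[of v W] cW scaleR_diff_right)
  then have "norm (mean v W - mean v E) = norm (sum v W - n1 *\<^sub>R mean v E) / n1"
    using n(1) by simp
  also have "\<dots> \<le> I * D * n1 powr (1 / p) / (2 * (1 - u)) / n1"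
    using err n(1) by (intro divide_right_mono) auto
  finally have 1: "norm (mean v W - mean v E) \<le> I * D * n1 powr (-1 + 1 / p) / (2 * (1 - u))"
    unfolding bd .
  have "sum v (E - W) = (n1 + n2) *\<^sub>R mean v E - sum v W"
    using card_scaleR_mean[OF fin, of v] W(1) fin by (simp add: cE sum_diff)
  then have "mean v (E - W) - mean v E = - ((1 / n2) *\<^sub>R (sum v W - n1 *\<^sub>R mean v E))"
    using n by (simp add: mean_def[of v "E - W"] cEW scaleR_diff_right scaleR_add_left scaleR_add_right)
  then have "norm (mean v (E - W) - mean v E) = norm (sum v W - n1 *\<^sub>R mean v E) / n2"
    using n by simp
  also have "\<dots> \<le> (I * D * n1 powr (1 / p) / (2 * (1 - u))) / n1"
    using err n by (intro frac_le) (auto intro: order_trans[OF norm_ge_zero])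
  finally have 2: "norm (mean v (E - W) - mean v E) \<le> I * D * n1 powr (-1 + 1 / p) / (2 * (1 - u))"
    unfolding bd .
  show ?thesis using W(1) Wj EWj 1 2 unfolding n1_def by blast
qed

text \<open>
  The part labelled \<open>i\<close> gets \<open>a i\<close> elements of every class.  Taking \<open>a = (\<lambda>_. 1)\<close> gives colorful
  partitions; a single class gives partitions into parts of prescribed sizes.
\<close>

lemma mean_partition:
  fixes v :: "'e \<Rightarrow> 'a" and col :: "'e \<Rightarrow> 'j" and a :: "'t \<Rightarrow> nat"
  assumes "finite T" "T \<noteq> {}" "card T \<le> 2 ^ d" "finite E" "col ` E \<subseteq> J"
    and "\<And>j. j \<in> J \<Longrightarrow> card {e \<in> E. col e = j} = (\<Sum>i\<in>T. a i)"
    and "\<And>i. i \<in> T \<Longrightarrow> s \<le> real (a i)"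
    and "\<And>e f. e \<in> E \<Longrightarrow> f \<in> E \<Longrightarrow> col e = col f \<Longrightarrow> norm (v e - v f) \<le> D"
    and D0: "0 \<le> D" and s: "0 < s" and J: "finite J" "J \<noteq> {}"
  shows "\<exists>lab. lab ` E \<subseteq> T \<and> (\<forall>j\<in>J. \<forall>i\<in>T. card {e \<in> E. col e = j \<and> lab e = i} = a i) \<and>
    (\<forall>i\<in>T. norm (mean v {e \<in> E. lab e = i} - mean v E)
      \<le> I * D * (real (card J) * s) powr (-1 + 1 / p) / (2 * u * (1 - u)) * (\<Sum>k<d. u ^ k))"
  using assms(1-8)
proof (induction d arbitrary: T E)
  case 0
  then obtain i where T: "T = {i}" by (metis card_1_singletonE card_gt_0_iff One_nat_def Suc_leI le_antisym power_0)
  have "card {e \<in> E. col e = j \<and> i = i'} = a i'" if "j \<in> J" "i' \<in> T" for i' j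
    using 0(6)[OF that(1)] that(2) unfolding T by simp
  moreover have "{e \<in> E. i = i'} = E" if "i' \<in> T" for i' using that unfolding T by auto
  ultimately show ?case using T by (intro exI[of _ "\<lambda>_. i"]) (simp add: image_subset_iff)
next
  case (Suc d)
  define c where "c = I * D * (real (card J) * s) powr (-1 + 1 / p) / (2 * u * (1 - u))"
  have c0: "0 \<le> c" unfolding c_def using I_nonneg D0 u_pos u_less by (intro divide_nonneg_nonneg) auto
  show ?case
  proof (cases "card T \<le> 2 ^ d")
    case True
    \<comment> \<open>With at most \<open>2 ^ d\<close> labels the induction hypothesis applies to
      \<open>T\<close> itself, and the longer sum is only larger.\<close>
    have "c * (\<Sum>k<d. u ^ k) \<le> c * (\<Sum>k<Suc d. u ^ k)"
      using c0 u_pos by (intro mult_left_mono) auto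
    moreover have "\<exists>lab. lab ` E \<subseteq> T \<and> (\<forall>j\<in>J. \<forall>i\<in>T. card {e \<in> E. col e = j \<and> lab e = i} = a i) \<and>
        (\<forall>i\<in>T. norm (mean v {e \<in> E. lab e = i} - mean v E) \<le> c * (\<Sum>k<d. u ^ k))"
      unfolding c_def using Suc.prems True by (intro Suc.IH) auto
    ultimately show ?thesis unfolding c_def[symmetric] by (meson order_trans)
  next
    case False
    define A where "A S = (\<Sum>i\<in>S. a i)" for S
    \<comment> \<open>The labels are cut into halves as equal as possible; \<open>S1\<close> is the
      half with the smaller prescribed total, as \<open>split_classes\<close> requires. As
      \<open>card T\<close> exceeds \<open>2 ^ d\<close>, each half has at least
      \<open>2 ^ d / 2\<close> labels.\<close>
    obtain S where S: "S \<subseteq> T" "card S = card T div 2"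
      by (metis obtain_subset_with_card_n div_le_dividend)
    have fS: "finite S" using S Suc.prems(1) finite_subset by blast
    have cTS: "card (T - S) = card T - card T div 2" using S fS by (simp add: card_Diff_subset)
    obtain S1 S2 where S12: "S1 \<union> S2 = T" "S1 \<inter> S2 = {}" "A S1 \<le> A S2"
        "card S1 \<le> 2 ^ d" "card S2 \<le> 2 ^ d" "2 ^ d \<le> 2 * card S1" "2 ^ d \<le> 2 * card S2"
    proof -
      have *: "card S \<le> 2 ^ d" "card (T - S) \<le> 2 ^ d" "2 ^ d \<le> 2 * card S" "2 ^ d \<le> 2 * card (T - S)"
        using False Suc.prems(3) unfolding S(2) cTS by auto
      show thesis
      proof (cases "A S \<le> A (T - S)")
        case True
        then show thesis using * S(1) by (intro that[of S "T - S"]) auto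
      next
        case False
        then show thesis using * S(1) by (intro that[of "T - S" S]) auto
      qed
    qed
    have f12: "finite S1" "finite S2" using S12(1) Suc.prems(1) by auto
    have ne12: "S1 \<noteq> {}" "S2 \<noteq> {}" using S12(6,7) by auto
    have "A T = A S1 + A S2" unfolding A_def S12(1)[symmetric] using S12(2) f12 by (simp add: sum.union_disjoint)
    then have cardA: "card {e \<in> E. col e = j} = A S1 + A S2" if "j \<in> J" for j
      using Suc.prems(6)[OF that] by (simp add: A_def)
    have A1s: "real (card S1) * s \<le> real (A S1)"
    proof -
      have "real (card S1) * s = (\<Sum>i\<in>S1. s)" by simp
      also have "\<dots> \<le> (\<Sum>i\<in>S1. real (a i))" using S12(1) Suc.prems(7) by (intro sum_mono) auto
      finally show ?thesis by (simp add: A_def)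
    qed
    have "0 < real (card S1) * s" using s f12 ne12 by (simp add: card_gt_0_iff)
    then have "0 < real (A S1)" using A1s by linarith
    then have A1: "1 \<le> A S1" by simp
    have "\<exists>W\<subseteq>E. (\<forall>j\<in>J. card {e \<in> W. col e = j} = A S1 \<and> card {e \<in> E - W. col e = j} = A S2) \<and>
      norm (mean v W - mean v E) \<le> I * D * real (card J * A S1) powr (-1 + 1 / p) / (2 * (1 - u)) \<and>
      norm (mean v (E - W) - mean v E) \<le> I * D * real (card J * A S1) powr (-1 + 1 / p) / (2 * (1 - u))"
      by (rule split_classes[OF Suc.prems(4) _ D0 J Suc.prems(5) A1 S12(3)])
        (fact Suc.prems(8) cardA)+
    then obtain W where W: "W \<subseteq> E" "\<And>j. j \<in> J \<Longrightarrow> card {e \<in> W. col e = j} = A S1"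
        "\<And>j. j \<in> J \<Longrightarrow> card {e \<in> E - W. col e = j} = A S2"
        "norm (mean v W - mean v E) \<le> I * D * real (card J * A S1) powr (-1 + 1 / p) / (2 * (1 - u))"
        "norm (mean v (E - W) - mean v E) \<le> I * D * real (card J * A S1) powr (-1 + 1 / p) / (2 * (1 - u))"
      by blast
    \<comment> \<open>The side of \<open>S1\<close> takes at least \<open>2 ^ d / 2 * s\<close>
      elements of each class, and the exponent is negative. The factor \<open>2 ^ d\<close> becomes
      \<open>u ^ d\<close>, and the divisor \<open>2\<close> becomes the extra \<open>1 / u\<close>
      in \<open>c\<close>.\<close>
    have "I * D * real (card J * A S1) powr (-1 + 1 / p) / (2 * (1 - u)) \<le> c * u ^ d"
    proof -
      have cJ: "0 < real (card J)" using J by (simp add: card_gt_0_iff)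
      have "real (2 ^ d) \<le> real (2 * card S1)" using S12(6) unfolding of_nat_le_iff .
      then have "2 ^ d / 2 \<le> real (card S1)" by simp
      then have "2 ^ d / 2 * s \<le> real (A S1)" using A1s s by (meson mult_right_mono less_imp_le order_trans)
      then have "real (card J) * (2 ^ d / 2 * s) \<le> real (card J * A S1)"
        using cJ by simp
      then have "real (card J * A S1) powr (-1 + 1 / p) \<le> (real (card J) * (2 ^ d / 2 * s)) powr (-1 + 1 / p)"
        using p_gt cJ s by (intro powr_mono2') auto
      also have "real (card J) * (2 ^ d / 2 * s) = (2 ^ d / 2) * (real (card J) * s)" by simp
      also have "\<dots> powr (-1 + 1 / p) = (2 ^ d / 2) powr (-1 + 1 / p) * (real (card J) * s) powr (-1 + 1 / p)"
        by (rule powr_mult)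
      also have "(2 ^ d / 2) powr (-1 + 1 / p) = u ^ d / u"
      proof -
        have "(2 ^ d / 2 :: real) = 2 powr (real d - 1)" by (simp add: powr_diff powr_realpow)
        then have "(2 ^ d / 2) powr (-1 + 1 / p) = u powr (real d - 1)"
          unfolding u_def by (simp only: powr_powr mult.commute)
        then show ?thesis using u_pos by (simp add: powr_diff powr_realpow)
      qed
      finally have "I * D * real (card J * A S1) powr (-1 + 1 / p)
          \<le> I * D * (u ^ d / u * (real (card J) * s) powr (-1 + 1 / p))"
        using I_nonneg D0 by (intro mult_left_mono) auto
      then have "I * D * real (card J * A S1) powr (-1 + 1 / p) / (2 * (1 - u))
          \<le> I * D * (u ^ d / u * (real (card J) * s) powr (-1 + 1 / p)) / (2 * (1 - u))"
        using u_less by (intro divide_right_mono) auto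
      also have "\<dots> = c * u ^ d" unfolding c_def
        by (simp only: times_divide_eq_right times_divide_eq_left divide_divide_eq_left mult_ac)
      finally show ?thesis .
    qed
    then have step: "norm (mean v W - mean v E) \<le> c * u ^ d" "norm (mean v (E - W) - mean v E) \<le> c * u ^ d"
      using W(4,5) by linarith+
    have fW: "finite W" using W(1) Suc.prems(4) finite_subset by blast
    have "\<exists>lab. lab ` W \<subseteq> S1 \<and> (\<forall>j\<in>J. \<forall>i\<in>S1. card {e \<in> W. col e = j \<and> lab e = i} = a i) \<and>
        (\<forall>i\<in>S1. norm (mean v {e \<in> W. lab e = i} - mean v W) \<le> c * (\<Sum>k<d. u ^ k))"
      unfolding c_def
    proof (rule Suc.IH[OF f12(1) ne12(1) S12(4) fW])
      show "col ` W \<subseteq> J" using W(1) Suc.prems(5) by auto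
      show "card {e \<in> W. col e = j} = sum a S1" if "j \<in> J" for j using W(2)[OF that] by (simp add: A_def)
      show "s \<le> real (a i)" if "i \<in> S1" for i using that S12(1) Suc.prems(7) by auto
      show "norm (v e - v f) \<le> D" if "e \<in> W" "f \<in> W" "col e = col f" for e f
        using that W(1) Suc.prems(8) by auto
    qed
    then obtain lab1 where lab1: "lab1 ` W \<subseteq> S1"
        "\<And>j i. j \<in> J \<Longrightarrow> i \<in> S1 \<Longrightarrow> card {e \<in> W. col e = j \<and> lab1 e = i} = a i"
        "\<And>i. i \<in> S1 \<Longrightarrow> norm (mean v {e \<in> W. lab1 e = i} - mean v W) \<le> c * (\<Sum>k<d. u ^ k)"
      by blast
    have "\<exists>lab. lab ` (E - W) \<subseteq> S2 \<and> (\<forall>j\<in>J. \<forall>i\<in>S2. card {e \<in> E - W. col e = j \<and> lab e = i} = a i) \<and>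
        (\<forall>i\<in>S2. norm (mean v {e \<in> E - W. lab e = i} - mean v (E - W)) \<le> c * (\<Sum>k<d. u ^ k))"
      unfolding c_def
    proof (rule Suc.IH[OF f12(2) ne12(2) S12(5)])
      show "finite (E - W)" using Suc.prems(4) by simp
      show "col ` (E - W) \<subseteq> J" using Suc.prems(5) by auto
      show "card {e \<in> E - W. col e = j} = sum a S2" if "j \<in> J" for j using W(3)[OF that] by (simp add: A_def)
      show "s \<le> real (a i)" if "i \<in> S2" for i using that S12(1) Suc.prems(7) by auto
      show "norm (v e - v f) \<le> D" if "e \<in> E - W" "f \<in> E - W" "col e = col f" for e f
        using that Suc.prems(8) by auto
    qed
    then obtain lab2 where lab2: "lab2 ` (E - W) \<subseteq> S2"
        "\<And>j i. j \<in> J \<Longrightarrow> i \<in> S2 \<Longrightarrow> card {e \<in> E - W. col e = j \<and> lab2 e = i} = a i"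
        "\<And>i. i \<in> S2 \<Longrightarrow> norm (mean v {e \<in> E - W. lab2 e = i} - mean v (E - W)) \<le> c * (\<Sum>k<d. u ^ k)"
      by blast
    define lab where "lab e = (if e \<in> W then lab1 e else lab2 e)" for e
    have lab_W: "lab e = i \<longleftrightarrow> e \<in> W \<and> lab1 e = i" if "e \<in> E" "i \<in> S1" for e i
      using that lab2(1) S12(2) unfolding lab_def by auto
    have lab_EW: "lab e = i \<longleftrightarrow> e \<in> E - W \<and> lab2 e = i" if "e \<in> E" "i \<in> S2" for e i
      using that lab1(1) S12(2) unfolding lab_def by auto
    have eq1: "{e \<in> E. Q e \<and> lab e = i} = {e \<in> W. Q e \<and> lab1 e = i}" if "i \<in> S1" for i Q
      using lab_W[OF _ that] W(1) by blast
    have eq2: "{e \<in> E. Q e \<and> lab e = i} = {e \<in> E - W. Q e \<and> lab2 e = i}" if "i \<in> S2" for i Q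
      using lab_EW[OF _ that] by blast
    have "lab ` E \<subseteq> T" using lab1(1) lab2(1) S12(1) by (auto simp: lab_def)
    moreover have "card {e \<in> E. col e = j \<and> lab e = i} = a i" if "j \<in> J" "i \<in> T" for j i
    proof (cases "i \<in> S1")
      case True
      then show ?thesis using lab1(2)[OF that(1)] by (simp add: eq1)
    next
      case False
      then have "i \<in> S2" using that S12(1) by auto
      then show ?thesis using lab2(2)[OF that(1)] by (simp only: eq2)
    qed
    \<comment> \<open>The error of the cut, \<open>c * u ^ d\<close>, is the new term of the sum;
      the induction hypothesis for the half containing \<open>i\<close> gives the rest.\<close>
    moreover have "norm (mean v {e \<in> E. lab e = i} - mean v E) \<le> c * (\<Sum>k<Suc d. u ^ k)" if "i \<in> T" for i
    proof (cases "i \<in> S1")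
      case True
      then have "norm (mean v {e \<in> E. lab e = i} - mean v W) \<le> c * (\<Sum>k<d. u ^ k)"
        using lab1(3)[OF True] eq1[OF True, of "\<lambda>_. True"] by simp
      from norm_diff_triangle_le[OF this step(1)] show ?thesis by (simp add: distrib_left)
    next
      case False
      then have i: "i \<in> S2" using that S12(1) by auto
      then have "norm (mean v {e \<in> E. lab e = i} - mean v (E - W)) \<le> c * (\<Sum>k<d. u ^ k)"
        using lab2(3)[OF i] eq2[OF i, of "\<lambda>_. True"] by simp
      from norm_diff_triangle_le[OF this step(2)] show ?thesis by (simp add: distrib_left)
    qed
    ultimately show ?thesis unfolding c_def by blast
  qed
qed

text \<open>An average of class means with weights \<open>l j / L\<close> stays within
  \<open>\<tau>\<close> of \<open>x\<close>. \<open>rounding\<close> replaces it by the mean of an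
  actual set, and dividing its error by \<open>L\<close> gives the second summand.\<close>

lemma transversal_mean:
  fixes v :: "'e \<Rightarrow> 'a" and col :: "'e \<Rightarrow> 'j"
  assumes fin: "finite E"
    and D: "\<And>e f. e \<in> E \<Longrightarrow> f \<in> E \<Longrightarrow> col e = col f \<Longrightarrow> norm (v e - v f) \<le> D" and D0: "0 \<le> D"
    and l: "\<And>j. l j \<le> card {e \<in> E. col e = j}"
    and \<tau>: "\<And>j. j \<in> col ` E \<Longrightarrow> norm (mean v {e \<in> E. col e = j} - x) \<le> \<tau>"
    and L: "(\<Sum>j\<in>col ` E. l j) = L" "0 < L"
  shows "\<exists>W\<subseteq>E. (\<forall>j. card {e \<in> W. col e = j} = l j) \<and> card W = L \<and>
    norm (mean v W - x) \<le> \<tau> + I * D * real L powr (-1 + 1 / p) / (2 * (1 - u))"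
proof -
  let ?C = "\<lambda>j. {e \<in> E. col e = j}"
  define y where "y = (\<Sum>j\<in>col ` E. real (l j) *\<^sub>R mean v (?C j))"
  obtain W where W: "W \<subseteq> E" "\<forall>j. card {e \<in> W. col e = j} = l j"
    "norm (sum v W - y) \<le> I * D * real L powr (1 / p) / (2 * (1 - u))"
    using rounding[of E col v D l, OF fin D D0 l] unfolding L(1) y_def by blast
  have "finite W" "col ` W \<subseteq> col ` E" using W(1) fin finite_subset by auto
  then have cW: "card W = L"
    using sum.group[of W "col ` E" col "\<lambda>_. 1::nat"] W(2) fin by (simp add: L(1))
  have Lx: "real L *\<^sub>R x = (\<Sum>j\<in>col ` E. real (l j) *\<^sub>R x)"
    unfolding L(1)[symmetric] by (simp add: scaleR_sum_left)
  have "norm (y - real L *\<^sub>R x) \<le> (\<Sum>j\<in>col ` E. real (l j) * \<tau>)"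
    unfolding y_def Lx sum_subtractf[symmetric] scaleR_diff_right[symmetric]
    by (intro sum_norm_le) (auto intro!: mult_left_mono \<tau>)
  also have "\<dots> = real L * \<tau>" unfolding L(1)[symmetric] by (simp add: sum_distrib_right)
  finally have "norm (sum v W - real L *\<^sub>R x) \<le> I * D * real L powr (1 / p) / (2 * (1 - u)) + real L * \<tau>"
    using norm_diff_triangle_le[OF W(3)] by blast
  then have "norm (sum v W - real L *\<^sub>R x) / real L
      \<le> (I * D * real L powr (1 / p) / (2 * (1 - u)) + real L * \<tau>) / real L"
    by (intro divide_right_mono) auto
  also have "\<dots> = \<tau> + I * D * real L powr (-1 + 1 / p) / (2 * (1 - u))"
    using L(2) by (simp add: powr_shift add_divide_distrib del: add_uminus_conv_diff uminus_add_conv_diff)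
  also have "norm (sum v W - real L *\<^sub>R x) / real L = norm (mean v W - x)"
  proof -
    have "mean v W - x = (1 / real L) *\<^sub>R (sum v W - real L *\<^sub>R x)"
      using L(2) by (simp add: mean_def cW scaleR_diff_right)
    then show ?thesis by simp
  qed
  finally show ?thesis using W(1,2) cW by blast
qed

text \<open>\<open>mean_partition\<close> with a single color \<open>()\<close> and part sizes
  between \<open>r / 2\<close> and \<open>r\<close>. Using \<open>s = r / 2\<close> instead of
  \<open>r\<close> costs a further \<open>1 / u\<close>, whence \<open>u\<^sup>2\<close> in the
  denominator.\<close>

lemma small_parts_partition:
  fixes P :: "'a set"
  assumes P: "finite P" "P \<noteq> {}" and D: "\<And>x y. x \<in> P \<Longrightarrow> y \<in> P \<Longrightarrow> norm (x - y) \<le> D" and r: "1 \<le> r"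
  shows "\<exists>lab :: 'a \<Rightarrow> nat. \<forall>i\<in>lab ` P. card {x \<in> P. lab x = i} \<le> r \<and>
    norm (mean id {x \<in> P. lab x = i} - mean id P)
      \<le> I * D * real r powr (-1 + 1 / p) / (2 * u\<^sup>2 * (1 - u)\<^sup>2)"
proof -
  have D0: "0 \<le> D" using P(2) D by fastforce
  define b where "b = I * D * real r powr (-1 + 1 / p) / (2 * u\<^sup>2 * (1 - u)\<^sup>2)"
  have b0: "0 \<le> b" unfolding b_def using I_nonneg D0 by (intro divide_nonneg_nonneg) auto
  show ?thesis
  proof (cases "card P < r")
    \<comment> \<open>Fewer than \<open>r\<close> points form one part, whose mean is that of
      \<open>P\<close>.\<close>
    case True
    then show ?thesis using b0 unfolding b_def[symmetric] by (intro exI[of _ "\<lambda>_. 0"]) auto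
  next
    case False
    then obtain m :: nat and a where a: "m \<ge> 1" "(\<Sum>i<m. a i) = card P"
        "\<forall>i<m. r \<le> 2 * a i \<and> a i \<le> r"
      using sum_balanced[OF r, of "card P"] by auto
    have a2: "real r / 2 \<le> real (a i)" if "i < m" for i
    proof -
      have "real r \<le> real (2 * a i)" using a(3) that by (simp only: of_nat_le_iff)
      then show ?thesis by simp
    qed
    \<comment> \<open>The depth \<open>m\<close> is crude, but the geometric series is bounded
      independently of it.\<close>
    have "card {..<m} \<le> 2 ^ m" using less_exp[of m] by (simp add: less_imp_le)
    then have "\<exists>lab. lab ` P \<subseteq> {..<m} \<and>
        (\<forall>j\<in>{()}. \<forall>i\<in>{..<m}. card {x \<in> P. () = j \<and> lab x = i} = a i) \<and>
        (\<forall>i\<in>{..<m}. norm (mean id {x \<in> P. lab x = i} - mean id P)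
          \<le> I * D * (real (card {()}) * (real r / 2)) powr (-1 + 1 / p) / (2 * u * (1 - u)) * (\<Sum>k<m. u ^ k))"
    proof (intro mean_partition)
      show "{..<m} \<noteq> {}" using a(1) by (simp add: lessThan_empty_iff)
      show "card {x \<in> P. () = j} = sum a {..<m}" for j using a(2) by simp
      show "0 < real r / 2" using r by simp
    qed (use P(1) D D0 a2 in auto)
    then obtain lab where lab: "lab ` P \<subseteq> {..<m}"
        "\<And>i. i < m \<Longrightarrow> card {x \<in> P. lab x = i} = a i"
        "\<And>i. i < m \<Longrightarrow> norm (mean id {x \<in> P. lab x = i} - mean id P)
          \<le> I * D * (real r / 2) powr (-1 + 1 / p) / (2 * u * (1 - u)) * (\<Sum>k<m. u ^ k)"
      by auto
    have half: "(real r / 2) powr (-1 + 1 / p) = real r powr (-1 + 1 / p) / u"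
      unfolding u_def by (rule powr_divide)
    have "I * D * (real r / 2) powr (-1 + 1 / p) / (2 * u * (1 - u)) * (\<Sum>k<m. u ^ k)
        \<le> I * D * (real r / 2) powr (-1 + 1 / p) / (2 * u * (1 - u)) * (1 / (1 - u))"
      using I_nonneg D0 u_pos u_less by (intro mult_left_mono sum_u_le divide_nonneg_nonneg) auto
    also have "\<dots> = b" unfolding half b_def by (simp add: power2_eq_square)
    finally have "norm (mean id {x \<in> P. lab x = i} - mean id P) \<le> b" if "i < m" for i
      using lab(3)[OF that] by linarith
    then show ?thesis
      unfolding b_def[symmetric] using lab(1,2) a(3) by (intro exI[of _ lab]) auto
  qed
qed

section \<open>Colorful partitions, selection and weak nets\<close>

text \<open>Since \<open>2 powr (1 - 1 / p) - 1 = (1 - u) / u\<close>, this is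
  \<open>infratype_K\<close> when \<open>I\<close> is the infratype constant.\<close>

definition K :: real where "K = 2 * I * u / (1 - u)"
definition T :: real where "T = 2 * (K + I) / (1 - u)"

lemma K_nonneg: "0 \<le> K" and T_nonneg: "0 \<le> T"
  using I_nonneg u_pos u_less by (auto simp: K_def T_def)

lemma u_ge_half: "1 / 2 \<le> u"
proof -
  have "u\<^sup>2 \<le> u" using u_pos u_less by (simp add: power2_eq_square)
  then show ?thesis using u_ge by linarith
qed

text \<open>The left side is the constant of the rounding error in \<open>transversal_mean\<close>;
  the comparison uses \<open>1 / 2 \<le> 2 * u\<close>.\<close>

lemma K_bound: "I / (2 * (1 - u)) \<le> K"
proof -
  have "I / (2 * (1 - u)) = I * (1 / 2) / (1 - u)" by simp
  also have "\<dots> \<le> I * (2 * u) / (1 - u)"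
    using I_nonneg u_less u_ge_half by (intro divide_right_mono mult_left_mono) auto
  finally show ?thesis by (simp add: K_def ac_simps)
qed

lemma T_eq: "T = I * (2 * (1 + u)) / (1 - u)\<^sup>2"
  using u_less unfolding T_def K_def by (simp add: divide_simps power2_eq_square) (simp add: algebra_simps)

text \<open>The left side is the constant of \<open>small_parts_partition\<close>; here
  \<open>1 / (2 * u\<^sup>2) \<le> 1 \<le> 2 * (1 + u)\<close>.\<close>

lemma T_bound: "I / (2 * u\<^sup>2 * (1 - u)\<^sup>2) \<le> T"
proof -
  have "1 / (2 * u\<^sup>2) \<le> 2 * (1 + u)" using u_ge u_pos by (auto simp: divide_le_eq intro: order_trans[of _ "2 * u\<^sup>2"])
  then have "I * (1 / (2 * u\<^sup>2)) / (1 - u)\<^sup>2 \<le> I * (2 * (1 + u)) / (1 - u)\<^sup>2"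
    using I_nonneg by (intro divide_right_mono mult_left_mono) auto
  then show ?thesis unfolding T_eq by simp
qed

lemma T_bound': "I / (2 * u * (1 - u)\<^sup>2) \<le> T"
proof -
  have "u\<^sup>2 \<le> u" using u_pos u_less by (simp add: power2_eq_square)
  then have "I / (2 * u * (1 - u)\<^sup>2) \<le> I / (2 * u\<^sup>2 * (1 - u)\<^sup>2)"
    using I_nonneg u_pos u_less by (intro divide_left_mono mult_right_mono mult_pos_pos) auto
  then show ?thesis using T_bound by linarith
qed

text \<open>For a single vector both signs give the same norm.\<close>

lemma I_ge_1:
  assumes "(x::'a) \<noteq> 0"
  shows "1 \<le> I"
proof -
  obtain U where U: "U \<subseteq> {()}" "norm (sum (\<lambda>_. x) U - sum (\<lambda>_. x) ({()} - U))
      \<le> I * (\<Sum>e\<in>{()}. norm x powr p) powr (1 / p)"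
    using ex_signs[of "{()}" "\<lambda>_. x"] by blast
  have "U = {} \<or> U = {()}" using U(1) by blast
  then have "norm x \<le> I * (norm x powr p) powr (1 / p)" using U(2) by auto
  also have "(norm x powr p) powr (1 / p) = norm x" using p_gt by (simp add: powr_powr)
  finally show ?thesis using assms by simp
qed

section \<open>Colorful Tverberg partitions\<close>

text \<open>\<open>mean_partition\<close> with \<open>a = 1\<close> gives every label one element of
  each \<open>Z j\<close>. The point is the mean of all elements, and the hull of \<open>S i\<close>
  contains the mean of \<open>S i\<close>, which is near that point.\<close>

lemma colorful_partition_near:
  assumes Z: "color_classes r k Z" and r: "1 \<le> r" and k: "1 \<le> k"
  shows "\<exists>(x::'a) S. colorful_partition r k Z S \<and>
    (\<forall>i\<in>{1..k}. setdist {x} (convex hull (S i))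
      \<le> T * real r powr (-1 + 1 / p) * Max ((\<lambda>j. diameter (Z j)) ` {1..r}))"
proof -
  define D where "D = Max ((\<lambda>j. diameter (Z j)) ` {1..r})"
  define E where "E = (\<Union>j\<in>{1..r}. Z j)"
  define col where "col e = (SOME j. j \<in> {1..r} \<and> e \<in> Z j)" for e
  have fZ: "finite (Z j)" "card (Z j) = k" if "j \<in> {1..r}" for j
    using Z that by (auto simp: color_classes_def)
  have finE: "finite E" unfolding E_def using fZ by blast
  have diam: "diameter (Z j) \<le> D" if "j \<in> {1..r}" for j
    unfolding D_def using that by (intro Max_ge) auto
  have "0 \<le> diameter (Z 1)" using fZ[of 1] r by (intro diameter_ge_0 finite_imp_bounded) auto
  also have "\<dots> \<le> D" using diam[of 1] r by simp
  finally have D0: "0 \<le> D" .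
  have col: "col e \<in> {1..r}" "e \<in> Z (col e)" if "e \<in> E" for e
  proof -
    have "\<exists>j. j \<in> {1..r} \<and> e \<in> Z j" using that unfolding E_def by blast
    from someI_ex[OF this] show "col e \<in> {1..r}" "e \<in> Z (col e)" unfolding col_def by blast+
  qed
  have col_eq: "col e = j" if "e \<in> Z j" "j \<in> {1..r}" for e j
  proof (rule ccontr)
    assume ne: "col e \<noteq> j"
    have "e \<in> E" using that unfolding E_def by blast
    then have "e \<in> Z (col e) \<inter> Z j" "col e \<in> {1..r}" using col that by auto
    moreover have "disjoint_family_on Z {1..r}" using Z by (simp add: color_classes_def)
    ultimately show False using disjoint_family_onD ne that(2) by fastforce
  qed
  have cls: "{e \<in> E. col e = j} = Z j" if "j \<in> {1..r}" for j
  proof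
    show "{e \<in> E. col e = j} \<subseteq> Z j" using col(2) by blast
    show "Z j \<subseteq> {e \<in> E. col e = j}" using col_eq that unfolding E_def by blast
  qed
  have "\<exists>lab. lab ` E \<subseteq> {1..k} \<and>
      (\<forall>j\<in>{1..r}. \<forall>i\<in>{1..k}. card {e \<in> E. col e = j \<and> lab e = i} = 1) \<and>
      (\<forall>i\<in>{1..k}. norm (mean id {e \<in> E. lab e = i} - mean id E)
        \<le> I * D * (real (card {1..r}) * 1) powr (-1 + 1 / p) / (2 * u * (1 - u)) * (\<Sum>m<k. u ^ m))"
  proof (intro mean_partition)
    show "{1..k} \<noteq> {}" using k by simp
    show "card {1..k} \<le> 2 ^ k" using less_exp[of k] by simp
    show "col ` E \<subseteq> {1..r}" using col(1) by blast
    show "card {e \<in> E. col e = j} = (\<Sum>i\<in>{1..k}. 1)" if "j \<in> {1..r}" for j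
      using cls[OF that] fZ[OF that] by simp
    show "norm (id e - id f) \<le> D" if "e \<in> E" "f \<in> E" "col e = col f" for e f
      using diff_le_diameter[of "Z (col e)" e f] diam[of "col e"] fZ col[OF that(1)] col[OF that(2)] that(3)
      by fastforce
    show "{1..r} \<noteq> {}" using r by simp
  qed (use finE D0 in auto)
  then obtain lab where lab: "lab ` E \<subseteq> {1..k}"
      "\<And>i j. j \<in> {1..r} \<Longrightarrow> i \<in> {1..k} \<Longrightarrow> card {e \<in> E. col e = j \<and> lab e = i} = 1"
      "\<And>i. i \<in> {1..k} \<Longrightarrow> norm (mean id {e \<in> E. lab e = i} - mean id E)
        \<le> I * D * real r powr (-1 + 1 / p) / (2 * u * (1 - u)) * (\<Sum>m<k. u ^ m)"
    by auto
  define S where "S i = {e \<in> E. lab e = i}" for i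
  have SZ: "S i \<inter> Z j = {e \<in> E. col e = j \<and> lab e = i}" if "j \<in> {1..r}" for i j
    unfolding cls[OF that, symmetric] S_def by blast
  have "disjoint_family_on S {1..k}" by (auto simp: disjoint_family_on_def S_def)
  moreover have "(\<Union>i\<in>{1..k}. S i) = E" using lab(1) unfolding S_def by blast
  ultimately have part: "colorful_partition r k Z S"
    unfolding colorful_partition_def using SZ lab(2) by (simp add: E_def)
  have "setdist {mean id E} (convex hull (S i)) \<le> T * real r powr (-1 + 1 / p) * D" if i: "i \<in> {1..k}" for i
  proof -
    have "card (S i \<inter> Z 1) = 1" using SZ[of 1 i] lab(2)[of 1 i] i r by simp
    then have "S i \<noteq> {}" by auto
    then have "mean id (S i) \<in> convex hull (S i)"
      using mean_in_convex_hull[of "S i" id] finE by (simp add: S_def)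
    then have "setdist {mean id E} (convex hull (S i)) \<le> dist (mean id E) (mean id (S i))"
      by (intro setdist_le_dist) auto
    also have "\<dots> = norm (mean id (S i) - mean id E)" by (simp add: dist_norm norm_minus_commute)
    also have "\<dots> \<le> I * D * real r powr (-1 + 1 / p) / (2 * u * (1 - u)) * (\<Sum>m<k. u ^ m)"
      using lab(3)[OF i] unfolding S_def .
    also have "\<dots> \<le> I * D * real r powr (-1 + 1 / p) / (2 * u * (1 - u)) * (1 / (1 - u))"
      using I_nonneg D0 u_pos u_less by (intro mult_left_mono sum_u_le divide_nonneg_nonneg) auto
    also have "\<dots> = I / (2 * u * (1 - u)\<^sup>2) * (real r powr (-1 + 1 / p) * D)"
      by (simp add: power2_eq_square mult_ac)
    also have "\<dots> \<le> T * (real r powr (-1 + 1 / p) * D)"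
      using D0 by (intro mult_right_mono T_bound') auto
    finally show ?thesis by simp
  qed
  then show ?thesis using part unfolding D_def by blast
qed

lemma Tv_le:
  assumes r: "1 \<le> r" and k: "1 \<le> k"
  shows "Tv X r k \<le> ennreal (T * real r powr (-1 + 1 / p))"
  unfolding Tv_def
proof (rule SUP_least)
  fix Z :: "nat \<Rightarrow> 'a set" assume "Z \<in> {Z. color_classes r k Z}"
  then have Z: "color_classes r k Z" by simp
  obtain x :: 'a and S where S: "colorful_partition r k Z S"
    "\<And>i. i \<in> {1..k} \<Longrightarrow> setdist {x} (convex hull (S i))
      \<le> T * real r powr (-1 + 1 / p) * Max ((\<lambda>j. diameter (Z j)) ` {1..r})"
    using colorful_partition_near[OF Z r k] by blast
  let ?D = "Max ((\<lambda>j. diameter (Z j)) ` {1..r})"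
  let ?M = "Max ((\<lambda>i. setdist {x} (convex hull (S i))) ` {1..k})"
  have M: "?M \<le> T * real r powr (-1 + 1 / p) * ?D"
    using S(2) k by (subst Max_le_iff) auto
  have "finite (Z 1)" using Z r by (simp add: color_classes_def)
  then have "0 \<le> diameter (Z 1)" by (intro diameter_ge_0 finite_imp_bounded)
  also have "\<dots> \<le> ?D" using r by (intro Max_ge) auto
  \<comment> \<open>If \<open>?D = 0\<close>, as happens for \<open>k = 1\<close>, the quotient is
    \<open>0\<close> by convention.\<close>
  finally have "?M / ?D \<le> T * real r powr (-1 + 1 / p)"
    using M T_nonneg by (cases "?D = 0") (auto simp: pos_divide_le_eq)
  then show "(INF x::'a. INF S\<in>{S. colorful_partition r k Z S}.
      ennreal (Max ((\<lambda>i. setdist {x} (convex hull (S i))) ` {1..k}) / ?D))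
    \<le> ennreal (T * real r powr (-1 + 1 / p))"
    using S(1) by (intro INF_lower2[of x] INF_lower2[of S] ennreal_leI) auto
qed

section \<open>Selection of subsets and of tuples\<close>

definition \<beta> :: "nat \<Rightarrow> real" where "\<beta> r = (T + K) * real r powr (-1 + 1 / p)"

text \<open>The common start of both selection lemmas, with \<open>x\<close> the mean of
  \<open>P\<close>. The last conjunct adds the two errors: \<open>T\<close> pays for the means of
  the parts, \<open>K\<close> for rounding within the parts.\<close>

lemma ex_near_parts:
  fixes P :: "'a set"
  assumes P: "finite P" "P \<noteq> {}" and D: "\<And>x y. x \<in> P \<Longrightarrow> y \<in> P \<Longrightarrow> norm (x - y) \<le> D" and r: "1 \<le> r"
  shows "\<exists>(x :: 'a) (lab :: 'a \<Rightarrow> nat). (\<forall>i\<in>lab ` P. card {y \<in> P. lab y = i} \<le> r \<and>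
      norm (mean id {y \<in> P. lab y = i} - x) \<le> T * real r powr (-1 + 1 / p) * D) \<and>
    T * real r powr (-1 + 1 / p) * D + I * D * real r powr (-1 + 1 / p) / (2 * (1 - u)) \<le> \<beta> r * D"
proof -
  have D0: "0 \<le> D" using P(2) D by fastforce
  obtain lab :: "'a \<Rightarrow> nat" where lab: "\<forall>i\<in>lab ` P. card {x \<in> P. lab x = i} \<le> r \<and>
    norm (mean id {x \<in> P. lab x = i} - mean id P)
      \<le> I * D * real r powr (-1 + 1 / p) / (2 * u\<^sup>2 * (1 - u)\<^sup>2)"
    using small_parts_partition[OF P D r] by blast
  have "I * D * real r powr (-1 + 1 / p) / (2 * u\<^sup>2 * (1 - u)\<^sup>2)
      = I / (2 * u\<^sup>2 * (1 - u)\<^sup>2) * (real r powr (-1 + 1 / p) * D)" by simp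
  also have "\<dots> \<le> T * (real r powr (-1 + 1 / p) * D)"
    using D0 by (intro mult_right_mono T_bound) auto
  finally have 1: "I * D * real r powr (-1 + 1 / p) / (2 * u\<^sup>2 * (1 - u)\<^sup>2) \<le> T * real r powr (-1 + 1 / p) * D"
    by simp
  have "I * D * real r powr (-1 + 1 / p) / (2 * (1 - u))
      = I / (2 * (1 - u)) * (real r powr (-1 + 1 / p) * D)" by simp
  also have "\<dots> \<le> K * (real r powr (-1 + 1 / p) * D)"
    using D0 by (intro mult_right_mono K_bound) auto
  finally have "T * real r powr (-1 + 1 / p) * D + I * D * real r powr (-1 + 1 / p) / (2 * (1 - u)) \<le> \<beta> r * D"
    by (simp add: \<beta>_def algebra_simps)
  moreover have "\<forall>i\<in>lab ` P. card {y \<in> P. lab y = i} \<le> r \<and>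
      norm (mean id {y \<in> P. lab y = i} - mean id P) \<le> T * real r powr (-1 + 1 / p) * D"
    using lab 1 by (blast intro: order_trans)
  ultimately show ?thesis by blast
qed

lemma selection_subsets:
  fixes P :: "'a set"
  assumes P: "finite P" "P \<noteq> {}" and D: "\<And>x y. x \<in> P \<Longrightarrow> y \<in> P \<Longrightarrow> norm (x - y) \<le> D" and r: "1 \<le> r"
  shows "\<exists>x. card {A. A \<subseteq> P \<and> card A = r}
    \<le> r ^ r * card {A \<in> {A. A \<subseteq> P \<and> card A = r}. norm (mean id A - x) \<le> \<beta> r * D}"
proof -
  have D0: "0 \<le> D" using P(2) D by fastforce
  obtain x :: 'a and lab :: "'a \<Rightarrow> nat" where lab: "\<And>i. i \<in> lab ` P \<Longrightarrow> card {y \<in> P. lab y = i} \<le> r"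
    "\<And>i. i \<in> lab ` P \<Longrightarrow> norm (mean id {y \<in> P. lab y = i} - x) \<le> T * real r powr (-1 + 1 / p) * D"
    "T * real r powr (-1 + 1 / p) * D + I * D * real r powr (-1 + 1 / p) / (2 * (1 - u)) \<le> \<beta> r * D"
    using ex_near_parts[of P D r, OF P D r] by auto
  define F where "F = {A. A \<subseteq> P \<and> card A = r}"
  define profile where "profile A = (\<lambda>i. card {y \<in> A. lab y = i})" for A
  have finF: "finite F" unfolding F_def using P(1) by simp
  have "card F \<le> r ^ r * card {A \<in> F. norm (mean id A - x) \<le> \<beta> r * D}"
  proof (rule card_le_fibres[OF finF, where f = profile])
    fix A assume A: "A \<in> F"
    then have A': "A \<subseteq> P" "card A = r" and fA: "finite A"
      using P(1) finite_subset by (auto simp: F_def)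
    let ?S = "\<lambda>e. {y \<in> P. lab y = lab e}"
    \<comment> \<open>A set with the same profile is the image of \<open>A\<close> under a map that preserves the parts.\<close>
    have "{B \<in> F. profile B = profile A} \<subseteq> (\<lambda>g. g ` A) ` (PiE A ?S)"
    proof
      fix B assume "B \<in> {B \<in> F. profile B = profile A}"
      then have B: "B \<subseteq> P" "finite B" and t: "profile B = profile A"
        using P(1) finite_subset by (auto simp: F_def)
      have "\<forall>i. \<exists>h. bij_betw h {y \<in> A. lab y = i} {y \<in> B. lab y = i}"
      proof
        fix i
        have "card {y \<in> A. lab y = i} = card {y \<in> B. lab y = i}" using fun_cong[OF t, of i] by (simp add: profile_def)
        then show "\<exists>h. bij_betw h {y \<in> A. lab y = i} {y \<in> B. lab y = i}"
          using fA B(2) by (intro finite_same_card_bij) auto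
      qed
      from choice[OF this] obtain h where "\<forall>i. bij_betw (h i) {y \<in> A. lab y = i} {y \<in> B. lab y = i}" ..
      then have h: "h i ` {y \<in> A. lab y = i} = {y \<in> B. lab y = i}" for i by (simp add: bij_betw_def)
      define g where "g = restrict (\<lambda>e. h (lab e) e) A"
      have "g ` A = (\<Union>i. h i ` {y \<in> A. lab y = i})" by (auto simp: g_def)
      also have "\<dots> = B" unfolding h by auto
      finally have "g ` A = B" .
      moreover have "g e \<in> ?S e" if "e \<in> A" for e
      proof -
        have "h (lab e) e \<in> h (lab e) ` {y \<in> A. lab y = lab e}" using that by blast
        then show ?thesis unfolding h using that B(1) by (auto simp: g_def)
      qed
      then have "g \<in> PiE A ?S" unfolding PiE_def Pi_def extensional_def by (simp add: g_def)
      ultimately show "B \<in> (\<lambda>g. g ` A) ` (PiE A ?S)" by blast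
    qed
    moreover have fin: "finite (PiE A ?S)" using fA P(1) by (intro finite_PiE) auto
    ultimately have "card {B \<in> F. profile B = profile A} \<le> card (PiE A ?S)"
      by (meson card_image_le card_mono finite_imageI order_trans)
    also have "\<dots> = (\<Prod>e\<in>A. card (?S e))" by (rule card_PiE[OF fA])
    \<comment> \<open>Each of the \<open>r\<close> points of \<open>A\<close> has at most
      \<open>r\<close> possible images, namely the points of its own part.\<close>
    also have "\<dots> \<le> (\<Prod>e\<in>A. r)" using A'(1) lab(1) by (intro prod_mono) auto
    finally show "card {B \<in> F. profile B = profile A} \<le> r ^ r" using A'(2) by simp
    have "(\<Sum>i\<in>lab ` P. profile A i) = r"
      using sum.group[of A "lab ` P" lab "\<lambda>_. 1::nat"] fA P(1) A' by (simp add: profile_def image_mono)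
    moreover have "profile A i \<le> card {y \<in> P. lab y = i}" for i
      unfolding profile_def using P(1) A'(1) by (intro card_mono) auto
    ultimately have "\<exists>W\<subseteq>P. (\<forall>i. card {y \<in> W. lab y = i} = profile A i) \<and> card W = r \<and>
        norm (mean id W - x) \<le> T * real r powr (-1 + 1 / p) * D + I * D * real r powr (-1 + 1 / p) / (2 * (1 - u))"
      using P(1) D D0 lab(2) r by (intro transversal_mean) auto
    then obtain W where W: "W \<subseteq> P" "\<And>i. card {y \<in> W. lab y = i} = profile A i" "card W = r"
        "norm (mean id W - x) \<le> T * real r powr (-1 + 1 / p) * D + I * D * real r powr (-1 + 1 / p) / (2 * (1 - u))"
      by blast
    have "profile W = profile A" using W(2) by (intro ext) (simp add: profile_def)
    moreover have "W \<in> F" using W by (simp add: F_def)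
    ultimately show "\<exists>B\<in>F. profile B = profile A \<and> norm (mean id B - x) \<le> \<beta> r * D"
      using W(4) lab(3) by fastforce
  qed
  then show ?thesis unfolding F_def by blast
qed

text \<open>The tuples are grouped by the sequence of parts they visit; a group is a product of
  \<open>r\<close> parts and has at most \<open>r ^ r\<close> members. Taking the positions as
  colors and rounding to one element per position yields a member near \<open>x\<close>.\<close>

lemma selection_tuples:
  fixes P :: "'a set"
  assumes P: "finite P" "P \<noteq> {}" and D: "\<And>x y. x \<in> P \<Longrightarrow> y \<in> P \<Longrightarrow> norm (x - y) \<le> D" and r: "1 \<le> r"
  shows "\<exists>x. card P ^ r \<le> r ^ r * card {y \<in> {..<r} \<rightarrow>\<^sub>E P. norm (mean y {..<r} - x) \<le> \<beta> r * D}"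
proof -
  have D0: "0 \<le> D" using P(2) D by fastforce
  obtain x :: 'a and lab :: "'a \<Rightarrow> nat" where lab: "\<And>i. i \<in> lab ` P \<Longrightarrow> card {y \<in> P. lab y = i} \<le> r"
    "\<And>i. i \<in> lab ` P \<Longrightarrow> norm (mean id {y \<in> P. lab y = i} - x) \<le> T * real r powr (-1 + 1 / p) * D"
    "T * real r powr (-1 + 1 / p) * D + I * D * real r powr (-1 + 1 / p) / (2 * (1 - u)) \<le> \<beta> r * D"
    using ex_near_parts[of P D r, OF P D r] by auto
  define F where "F = {..<r} \<rightarrow>\<^sub>E P"
  define profile where "profile y = restrict (\<lambda>t. lab (y t)) {..<r}" for y
  have finF: "finite F" unfolding F_def using P(1) by (intro finite_PiE) auto
  have cF: "card F = card P ^ r" unfolding F_def by (simp add: card_PiE)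
  have "card F \<le> r ^ r * card {y \<in> F. norm (mean y {..<r} - x) \<le> \<beta> r * D}"
  proof (rule card_le_fibres[OF finF, where f = profile])
    fix y assume y: "y \<in> F"
    have yP: "y t \<in> P" if "t < r" for t using y that by (auto simp: F_def)
    let ?S = "\<lambda>t. {z \<in> P. lab z = lab (y t)}"
    have "{z \<in> F. profile z = profile y} \<subseteq> PiE {..<r} ?S"
    proof
      fix z assume "z \<in> {z \<in> F. profile z = profile y}"
      then have z: "z \<in> {..<r} \<rightarrow>\<^sub>E P" "profile z = profile y" by (auto simp: F_def)
      have "lab (z t) = lab (y t)" if "t < r" for t using fun_cong[OF z(2), of t] that by (simp add: profile_def)
      then show "z \<in> PiE {..<r} ?S" using z(1) by (auto simp: PiE_iff)
    qed
    then have "card {z \<in> F. profile z = profile y} \<le> card (PiE {..<r} ?S)"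
      using P(1) by (intro card_mono finite_PiE) auto
    also have "\<dots> = (\<Prod>t<r. card (?S t))" by (rule card_PiE) simp
    also have "\<dots> \<le> (\<Prod>t<r. r)" using yP lab(1) by (intro prod_mono) auto
    finally show "card {z \<in> F. profile z = profile y} \<le> r ^ r" by simp
    \<comment> \<open>A separate copy of the visited part for every position: a part may be visited
      several times, and the choices at different positions may coincide.\<close>
    define E where "E = (SIGMA t:{..<r}. ?S t)"
    define l where "l = (\<lambda>t::nat. if t < r then 1 else 0::nat)"
    have finE: "finite E" unfolding E_def using P(1) by auto
    have cls: "{e \<in> E. fst e = t} = Pair t ` ?S t" if "t < r" for t using that by (auto simp: E_def)
    have fstE: "fst ` E = {..<r}" unfolding E_def using yP by force
    have "mean snd {e \<in> E. fst e = t} = mean id (?S t)" if "t < r" for t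
      unfolding cls[OF that] mean_def by (simp add: card_image inj_on_def sum.reindex)
    moreover have "l t \<le> card {e \<in> E. fst e = t}" for t
    proof (cases "t < r")
      case True
      then have "(t, y t) \<in> {e \<in> E. fst e = t}" using yP by (auto simp: E_def)
      then show ?thesis using finE by (auto simp: l_def card_gt_0_iff Suc_le_eq)
    qed (simp add: l_def)
    ultimately have "\<exists>W\<subseteq>E. (\<forall>t. card {e \<in> W. fst e = t} = l t) \<and> card W = r \<and>
        norm (mean snd W - x) \<le> T * real r powr (-1 + 1 / p) * D + I * D * real r powr (-1 + 1 / p) / (2 * (1 - u))"
      using finE D D0 lab(2) r yP by (intro transversal_mean) (auto simp: fstE l_def, auto simp: E_def)
    then obtain W where W: "W \<subseteq> E" "\<And>t. card {e \<in> W. fst e = t} = l t" "card W = r"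
        "norm (mean snd W - x) \<le> T * real r powr (-1 + 1 / p) * D + I * D * real r powr (-1 + 1 / p) / (2 * (1 - u))"
      by blast
    \<comment> \<open>\<open>W\<close> has exactly one element over each position, so it is the
      graph of a tuple \<open>z\<close>.\<close>
    have "\<forall>t\<in>{..<r}. \<exists>z. {e \<in> W. fst e = t} = {(t, z)}"
    proof
      fix t assume "t \<in> {..<r}"
      then have "card {e \<in> W. fst e = t} = 1" using W(2) by (simp add: l_def)
      then obtain e where e: "{e \<in> W. fst e = t} = {e}" by (rule card_1_singletonE)
      then have "fst e = t" by blast
      then have "e = (t, snd e)" by (cases e) simp
      then show "\<exists>z. {e \<in> W. fst e = t} = {(t, z)}" using e by metis
    qed
    from bchoice[OF this] obtain z0 where z0: "\<forall>t\<in>{..<r}. {e \<in> W. fst e = t} = {(t, z0 t)}" ..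
    define z where "z = restrict z0 {..<r}"
    have z: "{e \<in> W. fst e = t} = {(t, z t)}" if "t < r" for t using z0 that by (simp add: z_def)
    have "W = (\<Union>t\<in>{..<r}. {e \<in> W. fst e = t})" using W(1) by (auto simp: E_def)
    also have "\<dots> = (\<lambda>t. (t, z t)) ` {..<r}" using z by auto
    finally have Wz: "W = (\<lambda>t. (t, z t)) ` {..<r}" .
    have "mean snd W = mean z {..<r}"
      unfolding Wz mean_def by (simp add: card_image inj_on_def sum.reindex)
    moreover have zS: "z t \<in> ?S t" if "t < r" for t
    proof -
      have "(t, z t) \<in> E" using Wz W(1) that by blast
      then show ?thesis by (simp add: E_def)
    qed
    then have "z \<in> F" unfolding F_def PiE_iff by (simp add: z_def)
    moreover have "profile z = profile y" unfolding profile_def using zS by (intro ext) (simp add: restrict_def)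
    ultimately show "\<exists>z\<in>F. profile z = profile y \<and> norm (mean z {..<r} - x) \<le> \<beta> r * D"
      using W(4) lab(3) by fastforce
  qed
  then show ?thesis unfolding cF unfolding F_def by blast
qed

text \<open>\<open>Sel\<close> admits positive radii, and \<open>I\<close> may be \<open>0\<close>
  in the zero space. A set of positive diameter contains a nonzero vector, which forces
  \<open>1 \<le> I\<close>.\<close>

lemma \<beta>_pos:
  assumes "0 < diameter (P :: 'a set)" "1 \<le> r"
  shows "0 < \<beta> r"
proof -
  have "\<not> P \<subseteq> {0}" using assms(1) by (auto dest!: subset_singletonD)
  then obtain x where "x \<in> P" "x \<noteq> 0" by blast
  then have "1 \<le> I" using I_ge_1 by blast
  then have "0 < T" using u_less K_nonneg unfolding T_def by (intro divide_pos_pos) auto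
  then show ?thesis unfolding \<beta>_def using K_nonneg assms(2) by (intro mult_pos_pos) auto
qed

lemma Sel_le:
  assumes r: "1 \<le> r"
  shows "Sel X r (real r powi (- int r)) \<le> ennreal (\<beta> r)"
  unfolding Sel_def
proof (rule SUP_least)
  fix P :: "'a set" assume "P \<in> {P. finite P \<and> card P \<ge> r \<and> diameter P > 0}"
  then have P: "finite P" "0 < diameter P" by auto
  have ne: "P \<noteq> {}" using P(2) by auto
  note \<beta> = \<beta>_pos[OF P(2) r]
  let ?F = "{A. A \<subseteq> P \<and> card A = r}"
  obtain x where x: "card ?F \<le> r ^ r * card {A \<in> ?F. norm (mean id A - x) \<le> \<beta> r * diameter P}"
    using selection_subsets[OF P(1) ne diff_le_diameter[OF P(1)] r] by blast
  let ?G = "{A. A \<subseteq> P \<and> card A = r \<and>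
    convex hull A \<inter> (\<lambda>b. x + (\<beta> r * diameter P) *\<^sub>R b) ` cball 0 1 \<noteq> {}}"
  have "{A \<in> ?F. norm (mean id A - x) \<le> \<beta> r * diameter P} \<subseteq> ?G"
  proof
    fix A assume "A \<in> {A \<in> ?F. norm (mean id A - x) \<le> \<beta> r * diameter P}"
    then have A: "A \<subseteq> P" "card A = r" "norm (mean id A - x) \<le> \<beta> r * diameter P" by auto
    define s where "s = \<beta> r * diameter P"
    have s: "0 < s" using \<beta> P(2) by (simp add: s_def)
    have "mean id A \<in> convex hull A"
      using mean_in_convex_hull[of A id] A r finite_subset[OF A(1) P(1)] by fastforce
    moreover have "mean id A = x + s *\<^sub>R ((1 / s) *\<^sub>R (mean id A - x))" using s by simp
    moreover have "(1 / s) *\<^sub>R (mean id A - x) \<in> cball 0 1"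
      using A(3) s by (simp add: s_def[symmetric] divide_le_eq)
    ultimately have "mean id A \<in> convex hull A \<inter> (\<lambda>b. x + s *\<^sub>R b) ` cball 0 1" by blast
    then show "A \<in> ?G" using A unfolding s_def by blast
  qed
  moreover have "finite ?G" using P(1) by simp
  ultimately have "card {A \<in> ?F. norm (mean id A - x) \<le> \<beta> r * diameter P} \<le> card ?G"
    by (rule card_mono[rotated])
  then have "card P choose r \<le> r ^ r * card ?G"
    using x n_subsets[OF P(1), of r] by (metis (no_types, lifting) mult_le_mono2 order_trans)
  then have "real (card P choose r) \<le> real (r ^ r * card ?G)" unfolding of_nat_le_iff .
  then have "real r powi (- int r) * real (card P choose r) \<le> real (card ?G)"
    using r by (simp add: power_int_minus field_simps)
  then show "(INF x::'a. INF \<alpha>\<in>{\<alpha>::real. \<alpha> > 0 \<and>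
            real (card {A. A \<subseteq> P \<and> card A = r \<and>
                           convex hull A \<inter> (\<lambda>b. x + (\<alpha> * diameter P) *\<^sub>R b) ` cball 0 1 \<noteq> {}})
              \<ge> real r powi (- int r) * real (card P choose r)}. ennreal \<alpha>) \<le> ennreal (\<beta> r)"
    using \<beta> by (intro INF_lower2[of x] INF_lower2[of "\<beta> r"]) auto
qed

section \<open>Weak nets\<close>

text \<open>A greedy construction. \<open>big N\<close> says that the points of \<open>N\<close>
  account on average for at least \<open>(\<epsilon> * n / r) ^ r\<close> hit tuples each; there are
  \<open>n ^ r\<close> tuples, so the size of \<open>N\<close> is bounded as claimed. A
  \<open>big\<close> set that is no net can be enlarged by one point, which cannot go on
  forever.\<close>

lemma weak_net:
  fixes P :: "'a set"
  assumes P: "finite P" "0 < diameter P" and r: "1 \<le> r" and \<epsilon>: "0 < \<epsilon>" "\<epsilon> < 1"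
  shows "\<exists>N. finite N \<and> N \<noteq> {} \<and> real (card N) \<le> real r ^ r * \<epsilon> powi (- int r) \<and>
    (\<forall>Y. Y \<subseteq> P \<and> real (card Y) \<ge> \<epsilon> * real (card P) \<longrightarrow>
      setdist N (convex hull Y) \<le> \<beta> r * diameter P)"
proof -
  define D where "D = diameter P"
  define n where "n = card P"
  define F where "F = {..<r} \<rightarrow>\<^sub>E P"
  define near where "near y f \<longleftrightarrow> norm (mean y {..<r} - f) \<le> \<beta> r * D" for y :: "nat \<Rightarrow> 'a" and f
  define hit where "hit N = {y \<in> F. \<exists>f\<in>N. near y f}" for N
  define big where "big N \<longleftrightarrow> finite N \<and> real (card N) * (\<epsilon> * real n) ^ r \<le> real r ^ r * real (card (hit N))" for N
  define net where "net N \<longleftrightarrow> (\<forall>Y. Y \<subseteq> P \<and> real (card Y) \<ge> \<epsilon> * real n \<longrightarrow>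
      (\<exists>f\<in>N. \<exists>z\<in>convex hull Y. norm (z - f) \<le> \<beta> r * D))" for N
  have ne: "P \<noteq> {}" using P(2) by auto
  have n: "0 < real n" unfolding n_def using P(1) ne by (simp add: card_gt_0_iff)
  have finF: "finite F" unfolding F_def using P(1) by (intro finite_PiE) auto
  have cF: "card F = n ^ r" unfolding F_def n_def by (simp add: card_PiE)
  have rr: "real r ^ r > 0" using r by simp
  have en: "0 < (\<epsilon> * real n) ^ r" using \<epsilon> n by simp
  have big_card: "real (card N) \<le> real r ^ r * \<epsilon> powi (- int r)" if "big N" for N
  proof -
    have "card (hit N) \<le> n ^ r" unfolding cF[symmetric] hit_def using finF by (intro card_mono) auto
    then have "real (card (hit N)) \<le> real (n ^ r)" unfolding of_nat_le_iff .
    then have "real r ^ r * real (card (hit N)) \<le> real r ^ r * real n ^ r" by (intro mult_left_mono) auto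
    then have "real (card N) * (\<epsilon> * real n) ^ r \<le> real r ^ r * real n ^ r"
      using that unfolding big_def by linarith
    then have "real (card N) * \<epsilon> ^ r * real n ^ r \<le> real r ^ r * real n ^ r"
      by (simp add: power_mult_distrib mult.assoc)
    then have "real (card N) * \<epsilon> ^ r \<le> real r ^ r" using n by simp
    then show ?thesis using \<epsilon> by (simp add: power_int_minus field_simps)
  qed
  \<comment> \<open>If \<open>Y\<close> is far from \<open>N\<close>, no tuple in \<open>Y\<close> is hit by \<open>N\<close>, so the selection point of \<open>Y\<close>
    hits only new tuples.\<close>
  have extend: "\<exists>x. x \<notin> N \<and> big (insert x N)" if bigN: "big N" and "\<not> net N" for N
  proof -
    obtain Y where Y: "Y \<subseteq> P" "real (card Y) \<ge> \<epsilon> * real n"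
        "\<And>f z. f \<in> N \<Longrightarrow> z \<in> convex hull Y \<Longrightarrow> \<not> norm (z - f) \<le> \<beta> r * D"
      using \<open>\<not> net N\<close> unfolding net_def by blast
    have fY: "finite Y" using Y(1) P(1) finite_subset by blast
    have "0 < \<epsilon> * real n" using \<epsilon> n by simp
    then have Yne: "Y \<noteq> {}" using Y(2) by auto
    have "norm (x - y) \<le> D" if "x \<in> Y" "y \<in> Y" for x y
      unfolding D_def using that Y(1) by (intro diff_le_diameter P) auto
    from selection_tuples[OF fY Yne this r]
    obtain x where x: "card Y ^ r \<le> r ^ r * card {y \<in> {..<r} \<rightarrow>\<^sub>E Y. near y x}"
      unfolding near_def by blast
    let ?G = "{y \<in> {..<r} \<rightarrow>\<^sub>E Y. near y x}"
    have "real (card Y ^ r) \<le> real (r ^ r * card ?G)" using x unfolding of_nat_le_iff .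
    moreover have "(\<epsilon> * real n) ^ r \<le> real (card Y) ^ r"
      using Y(2) \<epsilon> n by (intro power_mono) auto
    ultimately have G: "(\<epsilon> * real n) ^ r \<le> real r ^ r * real (card ?G)" by simp
    \<comment> \<open>The tuples in \<open>?G\<close> are near \<open>x\<close> but not hit by
      \<open>N\<close>; as there is at least one, \<open>x\<close> is a new point.\<close>
    then have "card ?G \<noteq> 0" using en by (metis mult_zero_right not_le of_nat_0)
    then have Gne: "?G \<noteq> {}" by (metis card.empty)
    have unhit: "y \<notin> hit N" if "y \<in> {..<r} \<rightarrow>\<^sub>E Y" for y
    proof -
      have "mean y {..<r} \<in> convex hull (y ` {..<r})" using r by (intro mean_in_convex_hull) (auto simp: lessThan_empty_iff)
      also have "\<dots> \<subseteq> convex hull Y" using that by (intro hull_mono) auto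
      finally show ?thesis using Y(3) unfolding hit_def near_def by blast
    qed
    have GF: "?G \<subseteq> F" using Y(1) PiE_mono[of "{..<r}" "\<lambda>_. Y" "\<lambda>_. P"] unfolding F_def by blast
    have "x \<notin> N"
    proof
      assume "x \<in> N"
      then have "?G \<subseteq> hit N" using GF unfolding hit_def by blast
      then show False using Gne unhit by blast
    qed
    moreover have "big (insert x N)"
    proof -
      have fG: "finite ?G" "finite (hit N)" using GF finF finite_subset unfolding hit_def by auto
      have "hit N \<inter> ?G = {}" using unhit by blast
      then have "card (hit N) + card ?G = card (hit N \<union> ?G)" using fG by (simp add: card_Un_disjoint)
      also have "\<dots> \<le> card (hit (insert x N))"
        using finF GF unfolding hit_def by (intro card_mono) auto
      finally have "real (card (hit N)) + real (card ?G) \<le> real (card (hit (insert x N)))"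
        unfolding of_nat_add[symmetric] of_nat_le_iff .
      then have "real r ^ r * (real (card (hit N)) + real (card ?G)) \<le> real r ^ r * real (card (hit (insert x N)))"
        by (intro mult_left_mono) auto
      moreover have "real (card (insert x N)) = real (card N) + 1"
        using \<open>x \<notin> N\<close> bigN unfolding big_def by simp
      ultimately show ?thesis using G bigN unfolding big_def by (simp add: distrib_left distrib_right)
    qed
    ultimately show ?thesis by blast
  qed
  have "\<exists>N. big N \<and> net N"
  proof (rule ccontr)
    assume none: "\<not> (\<exists>N. big N \<and> net N)"
    \<comment> \<open>Without a net, \<open>extend\<close> would produce \<open>big\<close> sets of
      every size, against \<open>big_card\<close>.\<close>
    have "\<exists>N. big N \<and> card N = m" for m
    proof (induction m)
      case 0
      have "big {}" by (simp add: big_def)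
      then show ?case by (intro exI[of _ "{}"]) simp
    next
      case (Suc m)
      then obtain N where N: "big N" "card N = m" by blast
      then obtain x where "x \<notin> N" "big (insert x N)" using extend none by blast
      then show ?case using N unfolding big_def by (intro exI[of _ "insert x N"]) simp
    qed
    moreover obtain m :: nat where "real r ^ r * \<epsilon> powi (- int r) < real m"
      using reals_Archimedean2 by blast
    ultimately show False using big_card by (metis not_le)
  qed
  then obtain N where N: "big N" "net N" by blast
  have near_Y: "\<exists>f\<in>N. \<exists>z\<in>convex hull Y. norm (z - f) \<le> \<beta> r * D"
    if "Y \<subseteq> P" "real (card Y) \<ge> \<epsilon> * real n" for Y
    using N(2)[unfolded net_def, rule_format, of Y] that by simp
  \<comment> \<open>\<open>P\<close> itself is an admissible \<open>Y\<close>, so a net cannot be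
    empty. The definition of \<open>WeakNet\<close> asks for this, since \<open>setdist\<close> of
    the empty set is \<open>0\<close>.\<close>
  have "\<epsilon> * real n \<le> real (card P)" using \<epsilon> n unfolding n_def by simp
  then have "N \<noteq> {}" using near_Y[of P] by auto
  moreover have "setdist N (convex hull Y) \<le> \<beta> r * diameter P"
    if Y: "Y \<subseteq> P" "real (card Y) \<ge> \<epsilon> * real (card P)" for Y
  proof -
    obtain f z where fz: "f \<in> N" "z \<in> convex hull Y" "norm (z - f) \<le> \<beta> r * D"
      using near_Y[unfolded n_def, OF Y] by blast
    have "setdist N (convex hull Y) \<le> dist f z" using fz by (intro setdist_le_dist)
    then show ?thesis using fz(3) by (simp add: dist_norm norm_minus_commute D_def)
  qed
  moreover have "finite N" using N(1) by (simp add: big_def)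
  ultimately show ?thesis using big_card[OF N(1)] by (intro exI[of _ N]) simp
qed

lemma WeakNet_le:
  assumes r: "1 \<le> r" and \<epsilon>: "0 < \<epsilon>" "\<epsilon> < 1"
  shows "WeakNet X \<epsilon> (real r ^ r * \<epsilon> powi (- int r)) \<le> ennreal (\<beta> r)"
  unfolding WeakNet_def
proof (rule SUP_least)
  fix P :: "'a set" assume "P \<in> {P. finite P \<and> diameter P > 0}"
  then have P: "finite P" "0 < diameter P" by auto
  obtain N where N: "finite N" "N \<noteq> {}" "real (card N) \<le> real r ^ r * \<epsilon> powi (- int r)"
    "\<And>Y. Y \<subseteq> P \<Longrightarrow> real (card Y) \<ge> \<epsilon> * real (card P) \<Longrightarrow> setdist N (convex hull Y) \<le> \<beta> r * diameter P"
    using weak_net[OF P r \<epsilon>] by blast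
  show "(INF F\<in>{F :: 'a set. finite F \<and> F \<noteq> {} \<and> real (card F) \<le> real r ^ r * \<epsilon> powi (- int r)}.
      SUP Y\<in>{Y. Y \<subseteq> P \<and> real (card Y) \<ge> \<epsilon> * real (card P)}.
        ennreal (setdist F (convex hull Y) / diameter P)) \<le> ennreal (\<beta> r)"
    using N P(2) by (intro INF_lower2[of N] SUP_least ennreal_leI) (auto simp: pos_divide_le_eq)
qed

end

theorem lemma9p4:
  fixes X :: "'a::banach itself" and p :: real and r k :: nat
  assumes "has_infratype X p" and "p > 1" and "r \<ge> 1" and "k \<ge> 2"
  shows "Tv X r k
           \<le> ennreal (2 * infratype_B X p / (1 - 2 powr (-1 + 1 / p)) * real r powr (-1 + 1 / p))
       \<and> Sel X r (real r powi (- int r))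
           \<le> ennreal ((2 * infratype_B X p / (1 - 2 powr (-1 + 1 / p)) + infratype_K X p)
                       * real r powr (-1 + 1 / p))
       \<and> (\<forall>\<epsilon>::real. 0 < \<epsilon> \<and> \<epsilon> < 1 \<longrightarrow>
           WeakNet X \<epsilon> (real r ^ r * \<epsilon> powi (- int r))
           \<le> ennreal ((2 * infratype_B X p / (1 - 2 powr (-1 + 1 / p)) + infratype_K X p)
                       * real r powr (-1 + 1 / p)))"
proof -
  \<comment> \<open>The least constant is itself an infratype bound, so the estimates for arbitrary
    \<open>I\<close> apply to it.\<close>
  interpret infratype X p "infratype_const X p"
    using assms(1,2) infratype_bound_infratype_const[OF assms(1)]
    by unfold_locales (auto simp: has_infratype_def)
  have "2 powr (1 - 1 / p) = 1 / u"
    unfolding u_def by (simp add: powr_minus[symmetric] divide_inverse flip: powr_minus)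
  then have "2 powr (1 - 1 / p) - 1 = (1 - u) / u" using u_pos by (simp add: diff_divide_distrib)
  then have K: "infratype_K X p = K" unfolding infratype_K_def K_def by simp
  have T: "2 * infratype_B X p / (1 - 2 powr (-1 + 1 / p)) = T"
    unfolding infratype_B_def K T_def u_def ..
  show ?thesis
    unfolding T K using Tv_le[of r k] Sel_le[of r] WeakNet_le[of r] assms(3,4) by (auto simp: \<beta>_def)
qed

end
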